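(* Let $m,n,p\geq 1$ and $i,j$ be integers such that $1\leq i<j\leq m$. Then there is a natural isomorphism of functors from $\mathcal{A}_{m+n+p-2}$ to $\mathcal{A}_{m,n,p}$: $$(\operatorname{Id}_m\times X)\,(\nabla_{m;j}^{p}\times \operatorname{Id}_n)\,\nabla_{m+p-1;i}^{n}\;\simeq\;(\nabla_{m;i}^{n}\times \operatorname{Id}_p)\,\nabla_{m+n-1;j+n-1}^{p}.$$
   Context: Fix a field $k$. For $n\ge 1$ let $A_n$ be the path algebra over $k$ of the quiver $\overrightarrow{\mathbb{A}}_n: 1\to 2\to\cdots\to n$, and let $\mathcal{A}_n$ be the category of finite-dimensional right $A_n$-modules, identified with representations of the quiver (so that the projective module $P_j$ has dimension $1$ exactly at the vertices $\ell\ge j$). More generally $\mathcal{A}_{m_1,\dots,m_r}$ is the category of finite-dimensional right modules over $A_{m_1}\otimes_k\cdots\otimes_k A_{m_r}$, i.e. representations of the product quiver $\overrightarrow{\mathbb{A}}_{m_1}\times\cdots\times\overrightarrow{\mathbb{A}}_{m_r}$ with all commutation relations. A module over a product with first factor $\overrightarrow{\mathbb{A}}_a^{op}$ is a module with a left $A_a$-action commuting with the right actions of the other factors (arrows in that factor are reversed). A module over a product quiver is standard with support $\mathsf{S}$ (a set of vertices) if, up to isomorphism, it is $k$ at each vertex of $\mathsf{S}$, $0$ elsewhere, with identity maps along arrows between two vertices of $\mathsf{S}$. For $1\le i\le m$ and $n\ge1$ let $\mathsf{S}_{m;i}^{n}$ be the set of triples $(\gamma,\mu,\nu)\in[1,m+n-1]\times[1,m]\times[1,n]$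 such that ($\mu\le i-1$ and $\gamma\le\mu$) or ($\mu=i$ and $\gamma\le i+\nu-1$) or ($\mu\ge i+1$ and $\gamma\le \mu+n-1$). Let $M_{m;i}^{n}$ be the standard $\overrightarrow{\mathbb{A}}_{m+n-1}^{op}\times\overrightarrow{\mathbb{A}}_m\times\overrightarrow{\mathbb{A}}_n$-module with support $\mathsf{S}_{m;i}^{n}$, and let $\nabla_{m;i}^{n}=\;?\otimes_{A_{m+n-1}}M_{m;i}^{n}:\mathcal{A}_{m+n-1}\to\mathcal{A}_{m,n}$. $\nabla\times\operatorname{Id}$ denotes the functor on modules over a product obtained by applying $\nabla$ (tensoring with the corresponding $M$) with respect to the first factor, the other factor being carried along; e.g. $\nabla_{m;j}^p\times\operatorname{Id}_n:\mathcal{A}_{m+p-1,n}\to\mathcal{A}_{m,p,n}$. $X$ denotes the flip equivalence exchanging two factors; $\operatorname{Id}_m\times X:\mathcal{A}_{m,p,n}\to\mathcal{A}_{m,n,p}$ exchanges the last two factors. *)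

theory Defs
  imports "Jordan_Normal_Form.Missing_VectorSpace" "HOL-Algebra.AbelCoset"
begin

section \<open>Categories, functors, natural isomorphisms\<close>

record ('o, 'm) category =
  Obj :: "'o set"
  Hom :: "'o \<Rightarrow> 'o \<Rightarrow> 'm set"
  Idn :: "'o \<Rightarrow> 'm"
  Cmp :: "'o \<Rightarrow> 'o \<Rightarrow> 'o \<Rightarrow> 'm \<Rightarrow> 'm \<Rightarrow> 'm"
    \<comment> \<open>\<open>Cmp C X Y Z g f\<close> is the composite of \<open>f : X \<rightarrow> Y\<close> and \<open>g : Y \<rightarrow> Z\<close>\<close>

definition is_category :: "('o, 'm) category \<Rightarrow> bool" where
  "is_category C \<longleftrightarrow>
     (\<forall>X\<in>Obj C. Idn C X \<in> Hom C X X) \<and>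
     (\<forall>X\<in>Obj C. \<forall>Y\<in>Obj C. \<forall>Z\<in>Obj C. \<forall>f\<in>Hom C X Y. \<forall>g\<in>Hom C Y Z. Cmp C X Y Z g f \<in> Hom C X Z) \<and>
     (\<forall>X\<in>Obj C. \<forall>Y\<in>Obj C. \<forall>f\<in>Hom C X Y.
        Cmp C X X Y f (Idn C X) = f \<and> Cmp C X Y Y (Idn C Y) f = f) \<and>
     (\<forall>W\<in>Obj C. \<forall>X\<in>Obj C. \<forall>Y\<in>Obj C. \<forall>Z\<in>Obj C. \<forall>f\<in>Hom C W X. \<forall>g\<in>Hom C X Y. \<forall>h\<in>Hom C Y Z.
        Cmp C W Y Z h (Cmp C W X Y g f) = Cmp C W X Z (Cmp C X Y Z h g) f)"

definition is_iso :: "('o, 'm) category \<Rightarrow> 'o \<Rightarrow> 'o \<Rightarrow> 'm \<Rightarrow> bool" where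
  "is_iso C X Y f \<longleftrightarrow> f \<in> Hom C X Y \<and>
     (\<exists>g\<in>Hom C Y X. Cmp C X Y X g f = Idn C X \<and> Cmp C Y X Y f g = Idn C Y)"

record ('o, 'm, 'p, 'n) cat_functor =
  FObj :: "'o \<Rightarrow> 'p"
  FMap :: "'o \<Rightarrow> 'o \<Rightarrow> 'm \<Rightarrow> 'n"
    \<comment> \<open>\<open>FMap F X Y f\<close> is the value of \<open>F\<close> on \<open>f : X \<rightarrow> Y\<close>\<close>

definition is_functor ::
  "('o, 'm) category \<Rightarrow> ('p, 'n) category \<Rightarrow> ('o, 'm, 'p, 'n) cat_functor \<Rightarrow> bool" where
  "is_functor C D F \<longleftrightarrow> is_category C \<and> is_category D \<and>
     (\<forall>X\<in>Obj C. FObj F X \<in> Obj D) \<and>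
     (\<forall>X\<in>Obj C. \<forall>Y\<in>Obj C. \<forall>f\<in>Hom C X Y. FMap F X Y f \<in> Hom D (FObj F X) (FObj F Y)) \<and>
     (\<forall>X\<in>Obj C. FMap F X X (Idn C X) = Idn D (FObj F X)) \<and>
     (\<forall>X\<in>Obj C. \<forall>Y\<in>Obj C. \<forall>Z\<in>Obj C. \<forall>f\<in>Hom C X Y. \<forall>g\<in>Hom C Y Z.
        FMap F X Z (Cmp C X Y Z g f) =
        Cmp D (FObj F X) (FObj F Y) (FObj F Z) (FMap F Y Z g) (FMap F X Y f))"

definition comp_functor (infixr \<open>\<circ>\<^sub>F\<close> 55) where
  "G \<circ>\<^sub>F F = \<lparr>FObj = (\<lambda>X. FObj G (FObj F X)),
              FMap = (\<lambda>X Y f. FMap G (FObj F X) (FObj F Y) (FMap F X Y f))\<rparr>"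

definition is_natural_iso ::
  "('o, 'm) category \<Rightarrow> ('p, 'n) category \<Rightarrow>
   ('o, 'm, 'p, 'n) cat_functor \<Rightarrow> ('o, 'm, 'p, 'n) cat_functor \<Rightarrow> ('o \<Rightarrow> 'n) \<Rightarrow> bool" where
  "is_natural_iso C D F G \<eta> \<longleftrightarrow> is_functor C D F \<and> is_functor C D G \<and>
     (\<forall>X\<in>Obj C. is_iso D (FObj F X) (FObj G X) (\<eta> X)) \<and>
     (\<forall>X\<in>Obj C. \<forall>Y\<in>Obj C. \<forall>f\<in>Hom C X Y.
        Cmp D (FObj F X) (FObj F Y) (FObj G Y) (\<eta> Y) (FMap F X Y f) =
        Cmp D (FObj F X) (FObj G X) (FObj G Y) (FMap G X Y f) (\<eta> X))"

definition naturally_isomorphic ::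
  "('o, 'm) category \<Rightarrow> ('p, 'n) category \<Rightarrow>
   ('o, 'm, 'p, 'n) cat_functor \<Rightarrow> ('o, 'm, 'p, 'n) cat_functor \<Rightarrow> bool" where
  "naturally_isomorphic C D F G \<longleftrightarrow> (\<exists>\<eta>. is_natural_iso C D F G \<eta>)"


section \<open>Quivers\<close>

text \<open>Only quivers without parallel arrows are needed, so an arrow is a pair of vertices.\<close>

record 'q quiver =
  verts :: "'q set"
  arrows :: "('q \<times> 'q) set"

definition linear_quiver :: "nat \<Rightarrow> nat quiver" where
  "linear_quiver n = \<lparr>verts = {1..n}, arrows = {(x, y). 1 \<le> x \<and> y = x + 1 \<and> y \<le> n}\<rparr>"

definition op_quiver :: "'q quiver \<Rightarrow> 'q quiver" where
  "op_quiver Q = \<lparr>verts = verts Q, arrows = (arrows Q)\<inverse>\<rparr>"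

text \<open>The vertices of a product are lists with one entry per factor; an arrow of the product
  is an arrow in exactly one factor.\<close>

definition prod_quiver :: "'q quiver list \<Rightarrow> 'q list quiver" where
  "prod_quiver Qs =
     (let Vs = {xs. length xs = length Qs \<and> (\<forall>l<length Qs. xs ! l \<in> verts (Qs ! l))} in
      \<lparr>verts = Vs,
       arrows = {(xs, xs[l := y]) | xs l y.
                   xs \<in> Vs \<and> l < length Qs \<and> (xs ! l, y) \<in> arrows (Qs ! l)}\<rparr>)"


section \<open>Representations\<close>

record ('q, 'k, 'v) rep =
  space :: "'q \<Rightarrow> ('k, 'v) module"
  act :: "'q \<Rightarrow> 'q \<Rightarrow> 'v \<Rightarrow> 'v"

text \<open>Finite-dimensional representations over \<open>K\<close> satisfying all commutation relations. In a
  product of linear quivers (possibly with some factors reversed) two parallel paths of length two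
  are either equal or the two sides of a square of the product.\<close>

definition is_rep :: "('k, 'z) ring_scheme \<Rightarrow> 'q quiver \<Rightarrow> ('q, 'k, 'v) rep \<Rightarrow> bool" where
  "is_rep K Q V \<longleftrightarrow>
     (\<forall>x\<in>verts Q. vectorspace K (space V x) \<and> vectorspace.fin_dim K (space V x)) \<and>
     (\<forall>(x, y)\<in>arrows Q. act V x y \<in> module_hom K (space V x) (space V y)) \<and>
     (\<forall>x y y' z. (x, y) \<in> arrows Q \<and> (y, z) \<in> arrows Q \<and> (x, y') \<in> arrows Q \<and> (y', z) \<in> arrows Q \<longrightarrow>
        (\<forall>v\<in>carrier (space V x). act V y z (act V x y v) = act V y' z (act V x y' v)))"

text \<open>Morphisms are extensional families of extensional maps, so that equality of morphisms is
  equality on the underlying spaces.\<close>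

definition rep_hom ::
  "('k, 'z) ring_scheme \<Rightarrow> 'q quiver \<Rightarrow> ('q, 'k, 'v) rep \<Rightarrow> ('q, 'k, 'w) rep \<Rightarrow> ('q \<Rightarrow> 'v \<Rightarrow> 'w) set" where
  "rep_hom K Q V W =
     {f \<in> (\<Pi>\<^sub>E x\<in>verts Q. carrier (space V x) \<rightarrow>\<^sub>E carrier (space W x)).
        (\<forall>x\<in>verts Q. f x \<in> module_hom K (space V x) (space W x)) \<and>
        (\<forall>(x, y)\<in>arrows Q. \<forall>v\<in>carrier (space V x). f y (act V x y v) = act W x y (f x v))}"

text \<open>The type \<open>'v\<close> plays the role of a universe: the objects are the representations all of
  whose spaces have their elements in \<open>'v\<close>.\<close>

definition rep_cat ::
  "('k, 'z) ring_scheme \<Rightarrow> 'q quiver \<Rightarrow> (('q, 'k, 'v) rep, 'q \<Rightarrow> 'v \<Rightarrow> 'v) category" where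
  "rep_cat K Q =
     \<lparr>Obj = {V. is_rep K Q V},
      Hom = rep_hom K Q,
      Idn = (\<lambda>V. \<lambda>x\<in>verts Q. \<lambda>v\<in>carrier (space V x). v),
      Cmp = (\<lambda>U V W g f. \<lambda>x\<in>verts Q. \<lambda>v\<in>carrier (space U x). g x (f x v))\<rparr>"

text \<open>The category \<open>\<A>\<^bsub>m\<^sub>1,\<dots>,m\<^sub>r\<^esub>\<close> is \<open>rep_cat K (A_quiver [m\<^sub>1, \<dots>, m\<^sub>r])\<close>.\<close>

definition A_quiver :: "nat list \<Rightarrow> nat list quiver" where
  "A_quiver ms = prod_quiver (map linear_quiver ms)"


section \<open>Tensor products over the path algebra of a linear quiver\<close>

definition free_space :: "('k, 'z) ring_scheme \<Rightarrow> 'x set \<Rightarrow> ('k, 'x \<Rightarrow> 'k) module" where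
  "free_space K X =
     \<lparr>carrier = {f. (\<forall>x. f x \<in> carrier K) \<and> (\<forall>x. x \<notin> X \<longrightarrow> f x = \<zero>\<^bsub>K\<^esub>) \<and> finite {x. f x \<noteq> \<zero>\<^bsub>K\<^esub>}},
      monoid.mult = undefined, one = undefined,
      zero = (\<lambda>_. \<zero>\<^bsub>K\<^esub>), add = (\<lambda>f g x. f x \<oplus>\<^bsub>K\<^esub> g x),
      smult = (\<lambda>c f x. c \<otimes>\<^bsub>K\<^esub> f x)\<rparr>"

definition basis_vec :: "('k, 'z) ring_scheme \<Rightarrow> 'x \<Rightarrow> 'x \<Rightarrow> 'k" where
  "basis_vec K x = (\<lambda>y. if y = x then \<one>\<^bsub>K\<^esub> else \<zero>\<^bsub>K\<^esub>)"

text \<open>The linear map between free spaces that sends the basis vector of \<open>x\<close> to that of \<open>\<phi> x\<close>.\<close>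

definition push :: "('k, 'z) ring_scheme \<Rightarrow> ('x \<Rightarrow> 'y) \<Rightarrow> ('x \<Rightarrow> 'k) \<Rightarrow> 'y \<Rightarrow> 'k" where
  "push K \<phi> f = (\<lambda>y. finsum K f {x. f x \<noteq> \<zero>\<^bsub>K\<^esub> \<and> \<phi> x = y})"

definition quot_space :: "('k, 'v, 'z) module_scheme \<Rightarrow> 'v set \<Rightarrow> ('k, 'v set) module" where
  "quot_space F N =
     \<lparr>carrier = a_rcosets\<^bsub>F\<^esub> N,
      monoid.mult = undefined, one = undefined,
      zero = N, add = set_add F,
      smult = (\<lambda>c C. \<Union>f\<in>C. N +>\<^bsub>F\<^esub> (c \<odot>\<^bsub>F\<^esub> f))\<rparr>"

text \<open>
  Let \<open>V\<close> be a representation of \<open>\<A>\<^sub>a \<times> Q\<close> and \<open>M\<close> one of \<open>\<A>\<^sub>a\<^sup>o\<^sup>p \<times> R\<close>. The space of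
  \<open>V \<otimes>\<^bsub>A\<^sub>a\<^esub> M\<close> at the vertex \<open>xs @ ys\<close> of \<open>R \<times> Q\<close> is the quotient of the direct sum over \<open>\<gamma>\<close> of the
  spaces \<open>V(\<gamma>,ys) \<otimes>\<^sub>K M(\<gamma>,xs)\<close> by the relations \<open>v\<alpha> \<otimes> m = v \<otimes> \<alpha>m\<close>, one for each arrow
  \<open>\<alpha> : \<gamma> \<rightarrow> \<gamma>'\<close> of the linear quiver, \<open>v \<in> V(\<gamma>,ys)\<close> and \<open>m \<in> M(\<gamma>',xs)\<close>; the left action of \<open>\<alpha>\<close> is the
  structure map \<open>M(\<gamma>',xs) \<rightarrow> M(\<gamma>,xs)\<close>. The generator \<open>(\<gamma>, v, m)\<close> stands for \<open>v \<otimes> m\<close> in the summand \<open>\<gamma>\<close>.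
\<close>

definition tensor_gens ::
  "nat \<Rightarrow> (nat list, 'k, 'v) rep \<Rightarrow> (nat list, 'k, 'w) rep \<Rightarrow> nat list \<Rightarrow> nat list \<Rightarrow> (nat \<times> 'v \<times> 'w) set" where
  "tensor_gens a V M xs ys =
     {(\<gamma>, v, m). \<gamma> \<in> verts (linear_quiver a) \<and>
        v \<in> carrier (space V (\<gamma> # ys)) \<and> m \<in> carrier (space M (\<gamma> # xs))}"

definition tensor_rels ::
  "('k, 'z) ring_scheme \<Rightarrow> nat \<Rightarrow> (nat list, 'k, 'v) rep \<Rightarrow> (nat list, 'k, 'w) rep \<Rightarrow>
   nat list \<Rightarrow> nat list \<Rightarrow> (nat \<times> 'v \<times> 'w \<Rightarrow> 'k) set" where
  "tensor_rels K a V M xs ys =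
     (let F = free_space K (tensor_gens a V M xs ys);
          b = (\<lambda>\<gamma> v m. basis_vec K (\<gamma>, v, m));
          Vs = (\<lambda>\<gamma>. space V (\<gamma> # ys));
          Ms = (\<lambda>\<gamma>. space M (\<gamma> # xs));
          G = verts (linear_quiver a)
      in {b \<gamma> (v \<oplus>\<^bsub>Vs \<gamma>\<^esub> v') m \<ominus>\<^bsub>F\<^esub> (b \<gamma> v m \<oplus>\<^bsub>F\<^esub> b \<gamma> v' m) | \<gamma> v v' m.
            \<gamma> \<in> G \<and> v \<in> carrier (Vs \<gamma>) \<and> v' \<in> carrier (Vs \<gamma>) \<and> m \<in> carrier (Ms \<gamma>)} \<union>
         {b \<gamma> v (m \<oplus>\<^bsub>Ms \<gamma>\<^esub> m') \<ominus>\<^bsub>F\<^esub> (b \<gamma> v m \<oplus>\<^bsub>F\<^esub> b \<gamma> v m') | \<gamma> v m m'.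
            \<gamma> \<in> G \<and> v \<in> carrier (Vs \<gamma>) \<and> m \<in> carrier (Ms \<gamma>) \<and> m' \<in> carrier (Ms \<gamma>)} \<union>
         {b \<gamma> (c \<odot>\<^bsub>Vs \<gamma>\<^esub> v) m \<ominus>\<^bsub>F\<^esub> (c \<odot>\<^bsub>F\<^esub> b \<gamma> v m) | \<gamma> c v m.
            \<gamma> \<in> G \<and> c \<in> carrier K \<and> v \<in> carrier (Vs \<gamma>) \<and> m \<in> carrier (Ms \<gamma>)} \<union>
         {b \<gamma> v (c \<odot>\<^bsub>Ms \<gamma>\<^esub> m) \<ominus>\<^bsub>F\<^esub> (c \<odot>\<^bsub>F\<^esub> b \<gamma> v m) | \<gamma> c v m.
            \<gamma> \<in> G \<and> c \<in> carrier K \<and> v \<in> carrier (Vs \<gamma>) \<and> m \<in> carrier (Ms \<gamma>)} \<union>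
         {b \<gamma>' (act V (\<gamma> # ys) (\<gamma>' # ys) v) m \<ominus>\<^bsub>F\<^esub> b \<gamma> v (act M (\<gamma>' # xs) (\<gamma> # xs) m) | \<gamma> \<gamma>' v m.
            (\<gamma>, \<gamma>') \<in> arrows (linear_quiver a) \<and> v \<in> carrier (Vs \<gamma>) \<and> m \<in> carrier (Ms \<gamma>')})"

definition tensor_null ::
  "('k, 'z) ring_scheme \<Rightarrow> nat \<Rightarrow> (nat list, 'k, 'v) rep \<Rightarrow> (nat list, 'k, 'w) rep \<Rightarrow>
   nat list \<Rightarrow> nat list \<Rightarrow> (nat \<times> 'v \<times> 'w \<Rightarrow> 'k) set" where
  "tensor_null K a V M xs ys =
     LinearCombinations.module.span K (free_space K (tensor_gens a V M xs ys)) (tensor_rels K a V M xs ys)"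

definition tensor_space ::
  "('k, 'z) ring_scheme \<Rightarrow> nat \<Rightarrow> (nat list, 'k, 'v) rep \<Rightarrow> (nat list, 'k, 'w) rep \<Rightarrow>
   nat list \<Rightarrow> nat list \<Rightarrow> ('k, (nat \<times> 'v \<times> 'w \<Rightarrow> 'k) set) module" where
  "tensor_space K a V M xs ys =
     quot_space (free_space K (tensor_gens a V M xs ys)) (tensor_null K a V M xs ys)"

text \<open>The map into \<open>tensor_space K a V M xs ys\<close> that is induced by a map \<open>\<phi>\<close> on generators.\<close>

definition tensor_map ::
  "('k, 'z) ring_scheme \<Rightarrow> nat \<Rightarrow> (nat list, 'k, 'v) rep \<Rightarrow> (nat list, 'k, 'w) rep \<Rightarrow>
   nat list \<Rightarrow> nat list \<Rightarrow> ('g \<Rightarrow> nat \<times> 'v \<times> 'w) \<Rightarrow>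
   ('g \<Rightarrow> 'k) set \<Rightarrow> (nat \<times> 'v \<times> 'w \<Rightarrow> 'k) set" where
  "tensor_map K a V M xs ys \<phi> C =
     (\<Union>f\<in>C. tensor_null K a V M xs ys +>\<^bsub>free_space K (tensor_gens a V M xs ys)\<^esub> push K \<phi> f)"

text \<open>Here \<open>r\<close> is the number of factors of \<open>R\<close>, so that \<open>take r zs\<close> and \<open>drop r zs\<close> are the
  \<open>R\<close>- and \<open>Q\<close>-components of a vertex. An arrow of \<open>R \<times> Q\<close> changes exactly one of the two.\<close>

definition tensor_rep ::
  "('k, 'z) ring_scheme \<Rightarrow> nat \<Rightarrow> nat \<Rightarrow> (nat list, 'k, 'v) rep \<Rightarrow> (nat list, 'k, 'w) rep \<Rightarrow>
   (nat list, 'k, (nat \<times> 'v \<times> 'w \<Rightarrow> 'k) set) rep" where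
  "tensor_rep K a r V M =
     \<lparr>space = (\<lambda>zs. tensor_space K a V M (take r zs) (drop r zs)),
      act = (\<lambda>zs zs'. tensor_map K a V M (take r zs') (drop r zs')
        (\<lambda>(\<gamma>, v, m).
          (\<gamma>,
           if drop r zs = drop r zs' then v else act V (\<gamma> # drop r zs) (\<gamma> # drop r zs') v,
           if take r zs = take r zs' then m else act M (\<gamma> # take r zs) (\<gamma> # take r zs') m)))\<rparr>"

text \<open>The functor \<open>(? \<otimes>\<^bsub>A\<^sub>a\<^esub> M) \<times> Id\<close> from \<open>rep_cat K (A_quiver (a # ms))\<close> to
  \<open>rep_cat K (A_quiver (rs @ ms))\<close>, for \<open>M\<close> over \<open>\<A>\<^sub>a\<^sup>o\<^sup>p \<times> \<A>\<^bsub>rs\<^esub>\<close>.\<close>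

definition tensor_functor ::
  "('k, 'z) ring_scheme \<Rightarrow> nat \<Rightarrow> nat list \<Rightarrow> nat list \<Rightarrow> (nat list, 'k, 'w) rep \<Rightarrow>
   ((nat list, 'k, 'v) rep, nat list \<Rightarrow> 'v \<Rightarrow> 'v,
    (nat list, 'k, (nat \<times> 'v \<times> 'w \<Rightarrow> 'k) set) rep,
    nat list \<Rightarrow> (nat \<times> 'v \<times> 'w \<Rightarrow> 'k) set \<Rightarrow> (nat \<times> 'v \<times> 'w \<Rightarrow> 'k) set) cat_functor" where
  "tensor_functor K a rs ms M =
     (let r = length rs in
      \<lparr>FObj = (\<lambda>V. tensor_rep K a r V M),
       FMap = (\<lambda>V W f. \<lambda>zs\<in>verts (A_quiver (rs @ ms)).
         \<lambda>C\<in>carrier (tensor_space K a V M (take r zs) (drop r zs)).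
           tensor_map K a W M (take r zs) (drop r zs)
             (\<lambda>(\<gamma>, v, m). (\<gamma>, f (\<gamma> # drop r zs) v, m)) C)\<rparr>)"


section \<open>Standard modules and the functors \<open>\<nabla>\<close>\<close>

definition std_module :: "('k, 'z) ring_scheme \<Rightarrow> 'q set \<Rightarrow> ('q, 'k, 'k) rep" where
  "std_module K S =
     \<lparr>space = (\<lambda>x. \<lparr>carrier = (if x \<in> S then carrier K else {\<zero>\<^bsub>K\<^esub>}),
                    monoid.mult = undefined, one = undefined,
                    zero = \<zero>\<^bsub>K\<^esub>, add = add K, smult = monoid.mult K\<rparr>),
      act = (\<lambda>x y v. if x \<in> S \<and> y \<in> S then v else \<zero>\<^bsub>K\<^esub>)\<rparr>"

definition nabla_support :: "nat \<Rightarrow> nat \<Rightarrow> nat \<Rightarrow> nat list set" where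
  "nabla_support m i n =
     {[\<gamma>, \<mu>, \<nu>] | \<gamma> \<mu> \<nu>. \<gamma> \<in> {1..m + n - 1} \<and> \<mu> \<in> {1..m} \<and> \<nu> \<in> {1..n} \<and>
        (\<mu> \<le> i - 1 \<and> \<gamma> \<le> \<mu> \<or>
         \<mu> = i \<and> \<gamma> \<le> i + \<nu> - 1 \<or>
         \<mu> \<ge> i + 1 \<and> \<gamma> \<le> \<mu> + n - 1)}"

definition nabla_module ::
  "('k, 'z) ring_scheme \<Rightarrow> nat \<Rightarrow> nat \<Rightarrow> nat \<Rightarrow> (nat list, 'k, 'k) rep" where
  "nabla_module K m i n = std_module K (nabla_support m i n)"

text \<open>\<open>nabla K m i n ms\<close> is \<open>\<nabla>\<^sub>m\<^sub>;\<^sub>i\<^sup>n \<times> Id\<^bsub>ms\<^esub> : \<A>\<^bsub>m+n-1,ms\<^esub> \<rightarrow> \<A>\<^bsub>m,n,ms\<^esub>\<close>; in particular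
  \<open>nabla K m i n []\<close> is \<open>\<nabla>\<^sub>m\<^sub>;\<^sub>i\<^sup>n\<close> itself.\<close>

definition nabla ::
  "('k, 'z) ring_scheme \<Rightarrow> nat \<Rightarrow> nat \<Rightarrow> nat \<Rightarrow> nat list \<Rightarrow>
   ((nat list, 'k, 'v) rep, nat list \<Rightarrow> 'v \<Rightarrow> 'v,
    (nat list, 'k, (nat \<times> 'v \<times> 'k \<Rightarrow> 'k) set) rep,
    nat list \<Rightarrow> (nat \<times> 'v \<times> 'k \<Rightarrow> 'k) set \<Rightarrow> (nat \<times> 'v \<times> 'k \<Rightarrow> 'k) set) cat_functor" where
  "nabla K m i n ms = tensor_functor K (m + n - 1) [m, n] ms (nabla_module K m i n)"

definition swap_last_two :: "nat list \<Rightarrow> nat list" where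
  "swap_last_two xs = [xs ! 0, xs ! 2, xs ! 1]"

text \<open>\<open>Id\<^sub>m \<times> X : \<A>\<^bsub>m,p,n\<^esub> \<rightarrow> \<A>\<^bsub>m,n,p\<^esub>\<close>\<close>

definition flip_functor ::
  "nat \<Rightarrow> nat \<Rightarrow> nat \<Rightarrow>
   ((nat list, 'k, 'v) rep, nat list \<Rightarrow> 'v \<Rightarrow> 'v,
    (nat list, 'k, 'v) rep, nat list \<Rightarrow> 'v \<Rightarrow> 'v) cat_functor" where
  "flip_functor m p n =
     \<lparr>FObj = (\<lambda>V. \<lparr>space = (\<lambda>zs. space V (swap_last_two zs)),
                  act = (\<lambda>zs zs'. act V (swap_last_two zs) (swap_last_two zs'))\<rparr>),
      FMap = (\<lambda>V W f. \<lambda>zs\<in>verts (A_quiver [m, n, p]). f (swap_last_two zs))\<rparr>"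

end

theory Submission
  imports Defs
begin

text \<open>
  For fixed \<open>(\<mu>, \<nu>)\<close> the set of all \<open>\<gamma>\<close> with \<open>(\<gamma>, \<mu>, \<nu>)\<close> in the support of \<open>M\<^sub>m\<^sub>;\<^sub>i\<^sup>n\<close> is an interval
  \<open>{1..\<theta>(\<mu>, \<nu>)}\<close>. The left module over the linear quiver that sits there is the indecomposable projective
  one generated at \<open>\<theta>(\<mu>, \<nu>)\<close>, and \<open>V \<otimes> M\<close> at \<open>(\<mu>, \<nu>)\<close> is therefore \<open>V(\<theta>(\<mu>, \<nu>))\<close>. The map \<open>\<theta>\<close> is monotone,
  and the structure maps of \<open>V \<otimes> M\<close> are those of \<open>V\<close> along the paths between values of \<open>\<theta>\<close>. So \<open>\<nabla>\<close> is
  restriction along \<open>\<theta>\<close>, the map that replaces the vertex \<open>i\<close> by a chain of \<open>n\<close> vertices.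

  Both functors of the theorem are then restrictions along maps
  \<open>{1..m} \<times> {1..n} \<times> {1..p} \<rightarrow> {1..m + n + p - 2}\<close>, and these maps coincide, since the vertices
  \<open>i < j\<close> can be replaced in either order (\<open>nabla_vertex_exchange\<close>). Functors that restrict along
  the same map are naturally isomorphic (\<open>naturally_isomorphic_if_pull_back_alike\<close>).

  The main work is the description of the tensor product, which is given as a free space on all pairs
  modulo the span of the relations. The evaluation \<open>v \<otimes> c \<mapsto> c \<cdot> v\<alpha>\<close>, with \<open>\<alpha>\<close> the path to
  \<open>\<theta>(\<mu>, \<nu>)\<close>, maps the free space onto \<open>V(\<theta>(\<mu>, \<nu>))\<close>, and its kernel is exactly the span of the relations
  (\<open>N_eq_kernel\<close>). The cosets of the kernel are the fibres of the evaluation, so the elements of the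
  tensor product are the sets \<open>fibre F q w\<close>, one for each \<open>w\<close> in \<open>V(\<theta>(\<mu>, \<nu>))\<close>. Vector space structure,
  structure maps and functoriality are carried over along the bijection \<open>w \<mapsto> fibre F q w\<close>
  (\<open>restricts_along_tensor_functor\<close>).
\<close>


section \<open>Functors that restrict representations along a map of vertices\<close>

lemma is_functor_comp:
  assumes F: "is_functor C D F" and G: "is_functor D E G"
  shows "is_functor C E (G \<circ>\<^sub>F F)"
  using F G unfolding is_functor_def comp_functor_def by simp

lemma rep_homD:
  assumes "f \<in> rep_hom K Q V W" "x \<in> verts Q"
  shows "f x \<in> module_hom K (space V x) (space W x)"
    and "f x \<in> extensional (carrier (space V x))"
    and "v \<in> carrier (space V x) \<Longrightarrow> f x v \<in> carrier (space W x)"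
  using assms unfolding rep_hom_def by (auto simp: PiE_def)

lemma rep_hom_act:
  assumes "f \<in> rep_hom K Q V W" "(x, y) \<in> arrows Q" "v \<in> carrier (space V x)"
  shows "f y (act V x y v) = act W x y (f x v)"
  using assms unfolding rep_hom_def by auto

lemma rep_homI:
  assumes "f \<in> extensional (verts Q)"
    and "\<And>x. x \<in> verts Q \<Longrightarrow> f x \<in> extensional (carrier (space V x))"
    and "\<And>x. x \<in> verts Q \<Longrightarrow> f x \<in> module_hom K (space V x) (space W x)"
    and "\<And>x y v. (x, y) \<in> arrows Q \<Longrightarrow> v \<in> carrier (space V x) \<Longrightarrow>
           f y (act V x y v) = act W x y (f x v)"
  shows "f \<in> rep_hom K Q V W"
  using assms unfolding rep_hom_def by (auto simp: PiE_def Pi_def dest: module_hom_closed)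

lemma rep_hom_eqI:
  assumes f: "f \<in> rep_hom K Q V W" and g: "g \<in> rep_hom K Q V W"
    and eq: "\<And>x v. x \<in> verts Q \<Longrightarrow> v \<in> carrier (space V x) \<Longrightarrow> f x v = g x v"
  shows "f = g"
proof (rule extensionalityI)
  show "f \<in> extensional (verts Q)" "g \<in> extensional (verts Q)"
    using f g by (auto simp: rep_hom_def PiE_def)
  show "f x = g x" if "x \<in> verts Q" for x
    by (rule extensionalityI[OF rep_homD(2)[OF f that] rep_homD(2)[OF g that]]) (rule eq[OF that])
qed

lemma module_hom_comp:
  assumes "f \<in> module_hom K L M" "g \<in> module_hom K M N"
  shows "(\<lambda>v. g (f v)) \<in> module_hom K L N"
  using assms unfolding module_hom_def by (auto simp: Pi_def)

lemma module_hom_cong: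
  assumes "f \<in> module_hom K M N" "module K M" "\<And>v. v \<in> carrier M \<Longrightarrow> g v = f v"
  shows "g \<in> module_hom K M N"
proof -
  interpret module K M by fact
  show ?thesis using assms(1,3) unfolding module_hom_def by (auto simp: Pi_def)
qed

definition well_formed_quiver :: "'q quiver \<Rightarrow> bool" where
  "well_formed_quiver Q \<longleftrightarrow> (\<forall>(x, y)\<in>arrows Q. x \<in> verts Q \<and> y \<in> verts Q)"

lemma is_repD:
  assumes "is_rep K Q V"
  shows "x \<in> verts Q \<Longrightarrow> vectorspace K (space V x)"
    and "x \<in> verts Q \<Longrightarrow> module K (space V x)"
    and "x \<in> verts Q \<Longrightarrow> vectorspace.fin_dim K (space V x)"
    and "(x, y) \<in> arrows Q \<Longrightarrow> act V x y \<in> module_hom K (space V x) (space V y)"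
    and "(x, y) \<in> arrows Q \<Longrightarrow> v \<in> carrier (space V x) \<Longrightarrow> act V x y v \<in> carrier (space V y)"
    and "(x, y) \<in> arrows Q \<Longrightarrow> (y, z) \<in> arrows Q \<Longrightarrow> (x, y') \<in> arrows Q \<Longrightarrow> (y', z) \<in> arrows Q \<Longrightarrow>
          v \<in> carrier (space V x) \<Longrightarrow> act V y z (act V x y v) = act V y' z (act V x y' v)"
proof -
  have spaces: "vectorspace K (space V x) \<and> vectorspace.fin_dim K (space V x)" if "x \<in> verts Q" for x
    using assms that unfolding is_rep_def by simp
  have maps: "act V x y \<in> module_hom K (space V x) (space V y)" if "(x, y) \<in> arrows Q" for x y
    using assms that unfolding is_rep_def by auto
  show "x \<in> verts Q \<Longrightarrow> vectorspace K (space V x)" "x \<in> verts Q \<Longrightarrow> module K (space V x)"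
    "x \<in> verts Q \<Longrightarrow> vectorspace.fin_dim K (space V x)"
    using spaces by (auto simp: vectorspace_def)
  show "(x, y) \<in> arrows Q \<Longrightarrow> act V x y \<in> module_hom K (space V x) (space V y)"
    by (rule maps)
  show "(x, y) \<in> arrows Q \<Longrightarrow> v \<in> carrier (space V x) \<Longrightarrow> act V x y v \<in> carrier (space V y)"
    using maps[of x y] by (auto dest: module_hom_closed)
  show "(x, y) \<in> arrows Q \<Longrightarrow> (y, z) \<in> arrows Q \<Longrightarrow> (x, y') \<in> arrows Q \<Longrightarrow> (y', z) \<in> arrows Q \<Longrightarrow>
      v \<in> carrier (space V x) \<Longrightarrow> act V y z (act V x y v) = act V y' z (act V x y' v)"
    using conjunct2[OF conjunct2[OF assms[unfolded is_rep_def]]] by meson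
qed

text \<open>Well-formedness of the quiver matters: the spaces at the two ends of an arrow are constrained only
  if these ends are vertices, and a naturality square at an arrow needs both components.\<close>

lemma is_category_rep_cat:
  assumes Q: "well_formed_quiver Q"
  shows "is_category (rep_cat K Q)"
proof -
  have vs: "x \<in> verts Q" "y \<in> verts Q" if "(x, y) \<in> arrows Q" for x y
    using Q that by (auto simp: well_formed_quiver_def)
  have id: "(\<lambda>x\<in>verts Q. \<lambda>v\<in>carrier (space V x). v) \<in> rep_hom K Q V V" if V: "is_rep K Q V" for V
  proof (rule rep_homI, goal_cases)
    case (3 x)
    then interpret module K "space V x" using is_repD[OF V] by blast
    show ?case using 3 by (auto simp: module_hom_def)
  next
    case (4 x y v)
    then show ?case using vs[of x y] is_repD(5)[OF V, of x y v] by auto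
  qed auto
  have comp: "(\<lambda>x\<in>verts Q. \<lambda>v\<in>carrier (space U x). g x (f x v)) \<in> rep_hom K Q U W"
    if U: "is_rep K Q U" and f: "f \<in> rep_hom K Q U V" and g: "g \<in> rep_hom K Q V W" for U V W f g
  proof (rule rep_homI, goal_cases)
    case (3 x)
    have "(\<lambda>v. g x (f x v)) \<in> module_hom K (space U x) (space W x)"
      using module_hom_comp rep_homD(1)[OF f 3] rep_homD(1)[OF g 3] by blast
    then show ?case by (rule module_hom_cong) (use 3 is_repD(2)[OF U] in auto)
  next
    case (4 x y v)
    then show ?case
      using vs[of x y] is_repD(5)[OF U, of x y v] rep_hom_act[OF f, of x y v]
        rep_hom_act[OF g, of x y "f x v"] rep_homD(3)[OF f, of x v] by auto
  qed auto
  show ?thesis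
    unfolding is_category_def rep_cat_def
  proof (simp, intro conjI allI impI ballI, goal_cases)
    case 1
    then show ?case by (rule id)
  next
    case (2 X Y Z f g)
    then show ?case by (intro comp[of X f Y g Z])
  next
    case (3 X Y f)
    then show ?case
      by (intro rep_hom_eqI[of _ K Q X Y]) (use comp[of X "\<lambda>x\<in>verts Q. \<lambda>v\<in>carrier (space X x). v" X f Y] id[of X] in auto)
  next
    case (4 X Y f)
    then show ?case
      by (intro rep_hom_eqI[of _ K Q X Y])
        (use comp[of X f Y "\<lambda>x\<in>verts Q. \<lambda>v\<in>carrier (space Y x). v" Y] id[of Y] in \<open>auto dest: rep_homD(3)\<close>)
  next
    case (5 W X Y Z f g h)
    then show ?case
      using comp[OF 5(1) comp[OF 5(1) 5(5) 5(6)] 5(7)] comp[OF 5(1) 5(5) comp[OF 5(2) 5(6) 5(7)]]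
      by (intro rep_hom_eqI[of _ K Q W Z]) (auto dest: rep_homD(3))
  qed
qed

text \<open>The clause on zero is there because the codomain is usually a record whose module axioms are yet
  to be proved: only with the three operations and zero transported does it inherit them.\<close>

definition lin_iso ::
  "('k, 'z) ring_scheme \<Rightarrow> ('k, 'v, 'y) module_scheme \<Rightarrow> ('k, 'w, 'x) module_scheme \<Rightarrow> ('v \<Rightarrow> 'w) set" where
  "lin_iso K M N =
     {e \<in> module_hom K M N. bij_betw e (carrier M) (carrier N) \<and> e \<zero>\<^bsub>M\<^esub> = \<zero>\<^bsub>N\<^esub>}"

lemma lin_isoD:
  assumes "e \<in> lin_iso K M N"
  shows "e \<in> module_hom K M N" "bij_betw e (carrier M) (carrier N)"
    "inj_on e (carrier M)" "e ` carrier M = carrier N" "e \<zero>\<^bsub>M\<^esub> = \<zero>\<^bsub>N\<^esub>"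
    "v \<in> carrier M \<Longrightarrow> e v \<in> carrier N"
    "v \<in> carrier M \<Longrightarrow> v' \<in> carrier M \<Longrightarrow> e (v \<oplus>\<^bsub>M\<^esub> v') = e v \<oplus>\<^bsub>N\<^esub> e v'"
    "c \<in> carrier K \<Longrightarrow> v \<in> carrier M \<Longrightarrow> e (c \<odot>\<^bsub>M\<^esub> v) = c \<odot>\<^bsub>N\<^esub> e v"
  using assms by (auto simp: lin_iso_def bij_betw_def module_hom_def)

lemma lin_iso_comp:
  assumes "e \<in> lin_iso K L M" "e' \<in> lin_iso K M N"
  shows "(\<lambda>v. e' (e v)) \<in> lin_iso K L N"
  using assms module_hom_comp[of e K L M e' N]
    bij_betw_trans[of e "carrier L" "carrier M" e' "carrier N"]
  by (auto simp: lin_iso_def comp_def)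

lemma lin_iso_inv:
  assumes e: "e \<in> lin_iso K M N" and M: "module K M"
  shows "inv_into (carrier M) e \<in> lin_iso K N M"
proof -
  interpret module K M by fact
  note * = lin_isoD[OF e]
  let ?i = "inv_into (carrier M) e"
  have i: "?i (e v) = v" if "v \<in> carrier M" for v using *(3) that by simp
  have "?i \<in> module_hom K N M"
    unfolding module_hom_def *(4)[symmetric]
    by (auto simp: i *(7,8)[symmetric])
  moreover have "?i \<zero>\<^bsub>N\<^esub> = \<zero>\<^bsub>M\<^esub>" by (simp add: *(5)[symmetric] i)
  ultimately show ?thesis using bij_betw_inv_into[OF *(2)] by (simp add: lin_iso_def)
qed

lemma vectorspace_lin_iso:
  assumes e: "e \<in> lin_iso K M N" and M: "vectorspace K M"
  shows "vectorspace K N"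
    and "vectorspace.fin_dim K M \<Longrightarrow> vectorspace.fin_dim K N"
proof -
  interpret M: vectorspace K M by fact
  note * = lin_isoD[OF e]
  have "module K N"
  proof (rule moduleI)
    show "abelian_group N"
    proof (rule abelian_groupI)
      show "\<exists>y\<in>carrier N. y \<oplus>\<^bsub>N\<^esub> x = \<zero>\<^bsub>N\<^esub>" if "x \<in> carrier N" for x
      proof -
        from that obtain v where v: "v \<in> carrier M" "x = e v" using *(4) by blast
        have "e (\<ominus>\<^bsub>M\<^esub> v) \<oplus>\<^bsub>N\<^esub> x = \<zero>\<^bsub>N\<^esub>"
          using v by (simp add: *(7)[symmetric] *(5) M.M.l_neg)
        then show ?thesis using v by (intro bexI[of _ "e (\<ominus>\<^bsub>M\<^esub> v)"]) (auto simp: *(6))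
      qed
    qed (auto simp: *(4)[symmetric] *(7)[symmetric] *(5)[symmetric] M.M.a_ac)
  qed (auto simp: *(4)[symmetric] *(7,8)[symmetric] M.smult_l_distr M.smult_r_distr M.smult_assoc1
         M.R.is_cring)
  then show N: "vectorspace K N" by (simp add: vectorspace_def M.field.field_axioms)
  interpret linear_map K M N e
    using M N *(1) by (simp add: linear_map_def mod_hom_def mod_hom_axioms_def vectorspace_def)
  show "vectorspace.fin_dim K N" if "vectorspace.fin_dim K M"
    using surj_fin_dim[OF that *(4)] .
qed

text \<open>
  The functor \<open>F\<close> is, up to the isomorphisms \<open>e\<close>, restriction along \<open>\<psi>\<close>: at the vertex \<open>z\<close> its value on
  \<open>V\<close> is \<open>V(\<psi> z)\<close>. The map \<open>h V z z' : V(\<psi> z) \<rightarrow> V(\<psi> z')\<close> that belongs to an arrow \<open>z \<rightarrow> z'\<close> is a separate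
  datum, because \<open>\<psi>\<close> sends an arrow to a path or to a single vertex, not always to an arrow.
\<close>

definition restricts_along where
  "restricts_along K Q R F \<psi> h e \<longleftrightarrow>
     is_functor (rep_cat K Q) (rep_cat K R) F \<and>
     (\<forall>z\<in>verts R. \<psi> z \<in> verts Q) \<and>
     (\<forall>V. is_rep K Q V \<longrightarrow>
        (\<forall>z\<in>verts R. e V z \<in> lin_iso K (space V (\<psi> z)) (space (FObj F V) z)) \<and>
        (\<forall>(z, z')\<in>arrows R. \<forall>v\<in>carrier (space V (\<psi> z)).
           h V z z' v \<in> carrier (space V (\<psi> z')) \<and>
           act (FObj F V) z z' (e V z v) = e V z' (h V z z' v))) \<and>
     (\<forall>V W f. is_rep K Q V \<and> is_rep K Q W \<and> f \<in> rep_hom K Q V W \<longrightarrow>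
        (\<forall>z\<in>verts R. \<forall>v\<in>carrier (space V (\<psi> z)). FMap F V W f z (e V z v) = e W z (f (\<psi> z) v)))"

lemma restricts_alongD:
  assumes F: "restricts_along K Q R F \<psi> h e"
  shows "is_functor (rep_cat K Q) (rep_cat K R) F"
    and "z \<in> verts R \<Longrightarrow> \<psi> z \<in> verts Q"
    and "is_rep K Q V \<Longrightarrow> is_rep K R (FObj F V)"
    and "is_rep K Q V \<Longrightarrow> is_rep K Q W \<Longrightarrow> f \<in> rep_hom K Q V W \<Longrightarrow>
      FMap F V W f \<in> rep_hom K R (FObj F V) (FObj F W)"
    and "is_rep K Q V \<Longrightarrow> z \<in> verts R \<Longrightarrow> e V z \<in> lin_iso K (space V (\<psi> z)) (space (FObj F V) z)"
    and "is_rep K Q V \<Longrightarrow> (z, z') \<in> arrows R \<Longrightarrow> v \<in> carrier (space V (\<psi> z)) \<Longrightarrow>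
      h V z z' v \<in> carrier (space V (\<psi> z'))"
    and "is_rep K Q V \<Longrightarrow> (z, z') \<in> arrows R \<Longrightarrow> v \<in> carrier (space V (\<psi> z)) \<Longrightarrow>
      act (FObj F V) z z' (e V z v) = e V z' (h V z z' v)"
    and "is_rep K Q V \<Longrightarrow> is_rep K Q W \<Longrightarrow> f \<in> rep_hom K Q V W \<Longrightarrow> z \<in> verts R \<Longrightarrow>
      v \<in> carrier (space V (\<psi> z)) \<Longrightarrow> FMap F V W f z (e V z v) = e W z (f (\<psi> z) v)"
proof -
  show "is_functor (rep_cat K Q) (rep_cat K R) F"
    using F unfolding restricts_along_def by blast
  then show "is_rep K Q V \<Longrightarrow> is_rep K R (FObj F V)"
    and "is_rep K Q V \<Longrightarrow> is_rep K Q W \<Longrightarrow> f \<in> rep_hom K Q V W \<Longrightarrow>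
      FMap F V W f \<in> rep_hom K R (FObj F V) (FObj F W)"
    unfolding is_functor_def rep_cat_def by auto
qed (use F in \<open>unfold restricts_along_def, blast+\<close>)

lemma is_rep_lin_iso:
  assumes R: "well_formed_quiver R"
    and V: "\<And>z. z \<in> verts R \<Longrightarrow> vectorspace K (X z) \<and> vectorspace.fin_dim K (X z)"
    and e: "\<And>z. z \<in> verts R \<Longrightarrow> e z \<in> lin_iso K (X z) (space W z)"
    and h: "\<And>z z'. (z, z') \<in> arrows R \<Longrightarrow> h z z' \<in> module_hom K (X z) (X z')"
    and comm: "\<And>x y y' z v. (x, y) \<in> arrows R \<Longrightarrow> (y, z) \<in> arrows R \<Longrightarrow> (x, y') \<in> arrows R \<Longrightarrow>
       (y', z) \<in> arrows R \<Longrightarrow> v \<in> carrier (X x) \<Longrightarrow>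
       h y z (h x y v) = h y' z (h x y' v)"
    and act: "\<And>z z' v. (z, z') \<in> arrows R \<Longrightarrow> v \<in> carrier (X z) \<Longrightarrow>
        act W z z' (e z v) = e z' (h z z' v)"
  shows "is_rep K R W"
proof -
  have vs: "x \<in> verts R" "y \<in> verts R" if "(x, y) \<in> arrows R" for x y
    using R that by (auto simp: well_formed_quiver_def)
  have hc: "h z z' v \<in> carrier (X z')" if "(z, z') \<in> arrows R" "v \<in> carrier (X z)" for z z' v
    using module_hom_closed[OF h[OF that(1)]] that(2) by auto
  have "vectorspace K (space W x)" "vectorspace.fin_dim K (space W x)" if "x \<in> verts R" for x
    using vectorspace_lin_iso[OF e[OF that]] V[OF that] by auto
  moreover have "act W x y \<in> module_hom K (space W x) (space W y)" if a: "(x, y) \<in> arrows R" for x y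
  proof -
    note ex = lin_isoD[OF e[OF vs(1)[OF a]]] and ey = lin_isoD[OF e[OF vs(2)[OF a]]]
    interpret module K "X x" using V[OF vs(1)[OF a]] by (simp add: vectorspace_def)
    show ?thesis
      unfolding module_hom_def ex(4)[symmetric]
      using module_hom_add[OF h[OF a]] module_hom_smult[OF h[OF a]]
      by (auto simp: ex(7,8)[symmetric] act[OF a] ey(6-8)  hc[OF a])
  qed
  moreover have "act W y z (act W x y w) = act W y' z (act W x y' w)"
    if a: "(x, y) \<in> arrows R" "(y, z) \<in> arrows R" "(x, y') \<in> arrows R" "(y', z) \<in> arrows R"
      and w: "w \<in> carrier (space W x)" for x y y' z w
  proof -
    obtain v where v: "v \<in> carrier (X x)" "w = e x v"
      using w lin_isoD(4)[OF e[OF vs(1)[OF a(1)]]] by blast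
    show ?thesis using comm[OF a v(1)] a v by (simp add: act hc)
  qed
  ultimately show ?thesis unfolding is_rep_def by blast
qed

text \<open>Functoriality is a consequence of the other conditions: every element of \<open>(F V)(z)\<close> has the form
  \<open>e V z v\<close>, so each identity that \<open>F\<close> has to satisfy can be checked after moving it along \<open>e\<close> to
  the maps \<open>h\<close> and to the components \<open>f (\<psi> z)\<close>.\<close>

lemma restricts_alongI:
  assumes Q: "well_formed_quiver Q" and R: "well_formed_quiver R"
    and \<psi>: "\<And>z. z \<in> verts R \<Longrightarrow> \<psi> z \<in> verts Q"
    and e: "\<And>V z. is_rep K Q V \<Longrightarrow> z \<in> verts R \<Longrightarrow>
       e V z \<in> lin_iso K (space V (\<psi> z)) (space (FObj F V) z)"
    and h: "\<And>V z z'. is_rep K Q V \<Longrightarrow> (z, z') \<in> arrows R \<Longrightarrow>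
       h V z z' \<in> module_hom K (space V (\<psi> z)) (space V (\<psi> z'))"
    and comm: "\<And>V x y y' z v. is_rep K Q V \<Longrightarrow> (x, y) \<in> arrows R \<Longrightarrow> (y, z) \<in> arrows R \<Longrightarrow>
       (x, y') \<in> arrows R \<Longrightarrow> (y', z) \<in> arrows R \<Longrightarrow> v \<in> carrier (space V (\<psi> x)) \<Longrightarrow>
       h V y z (h V x y v) = h V y' z (h V x y' v)"
    and act: "\<And>V z z' v. is_rep K Q V \<Longrightarrow> (z, z') \<in> arrows R \<Longrightarrow> v \<in> carrier (space V (\<psi> z)) \<Longrightarrow>
        act (FObj F V) z z' (e V z v) = e V z' (h V z z' v)"
    and nat: "\<And>V W f z z' v. is_rep K Q V \<Longrightarrow> is_rep K Q W \<Longrightarrow> f \<in> rep_hom K Q V W \<Longrightarrow>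
       (z, z') \<in> arrows R \<Longrightarrow> v \<in> carrier (space V (\<psi> z)) \<Longrightarrow>
       f (\<psi> z') (h V z z' v) = h W z z' (f (\<psi> z) v)"
    and ext: "\<And>V W f. is_rep K Q V \<Longrightarrow> is_rep K Q W \<Longrightarrow> f \<in> rep_hom K Q V W \<Longrightarrow>
       FMap F V W f \<in> extensional (verts R)"
    and ext': "\<And>V W f z. is_rep K Q V \<Longrightarrow> is_rep K Q W \<Longrightarrow> f \<in> rep_hom K Q V W \<Longrightarrow> z \<in> verts R \<Longrightarrow>
       FMap F V W f z \<in> extensional (carrier (space (FObj F V) z))"
    and map: "\<And>V W f z v. is_rep K Q V \<Longrightarrow> is_rep K Q W \<Longrightarrow> f \<in> rep_hom K Q V W \<Longrightarrow>
       z \<in> verts R \<Longrightarrow> v \<in> carrier (space V (\<psi> z)) \<Longrightarrow>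
       FMap F V W f z (e V z v) = e W z (f (\<psi> z) v)"
  shows "restricts_along K Q R F \<psi> h e"
proof -
  have vs: "x \<in> verts R" "y \<in> verts R" if "(x, y) \<in> arrows R" for x y
    using R that by (auto simp: well_formed_quiver_def)
  have hc: "h V z z' v \<in> carrier (space V (\<psi> z'))"
    if "is_rep K Q V" "(z, z') \<in> arrows R" "v \<in> carrier (space V (\<psi> z))" for V z z' v
    using module_hom_closed[OF h[OF that(1,2)]] that(3) by auto
  have obj: "is_rep K R (FObj F V)" if V: "is_rep K Q V" for V
  proof (rule is_rep_lin_iso[OF R, where X = "\<lambda>z. space V (\<psi> z)" and e = "e V" and h = "h V"])
    show "vectorspace K (space V (\<psi> z)) \<and> vectorspace.fin_dim K (space V (\<psi> z))" if "z \<in> verts R" for z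
      using is_repD(1,3)[OF V \<psi>[OF that]] by simp
  qed (fact e[OF V] h[OF V] comm[OF V] act[OF V])+
  have mor: "FMap F V W f \<in> rep_hom K R (FObj F V) (FObj F W)"
    if V: "is_rep K Q V" and W: "is_rep K Q W" and f: "f \<in> rep_hom K Q V W" for V W f
  proof (rule rep_homI)
    show "FMap F V W f \<in> extensional (verts R)" by (rule ext[OF V W f])
    show "FMap F V W f z \<in> extensional (carrier (space (FObj F V) z))" if "z \<in> verts R" for z
      by (rule ext'[OF V W f that])
    show "FMap F V W f z \<in> module_hom K (space (FObj F V) z) (space (FObj F W) z)" if z: "z \<in> verts R" for z
    proof -
      note eV = lin_isoD[OF e[OF V z]] and eW = lin_isoD[OF e[OF W z]]
      interpret module K "space V (\<psi> z)" using is_repD[OF V] \<psi> z by blast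
      note fz = rep_homD[OF f \<psi>[OF z]]
      show ?thesis
        unfolding module_hom_def eV(4)[symmetric]
        using module_hom_add[OF fz(1)] module_hom_smult[OF fz(1)]
        by (auto simp: eV(7,8)[symmetric] map[OF V W f z] eW(6-8) fz(3))
    qed
    show "FMap F V W f z' (act (FObj F V) z z' w) = act (FObj F W) z z' (FMap F V W f z w)"
      if a: "(z, z') \<in> arrows R" and w: "w \<in> carrier (space (FObj F V) z)" for z z' w
    proof -
      obtain v where v: "v \<in> carrier (space V (\<psi> z))" "w = e V z v"
        using w lin_isoD(4)[OF e[OF V vs(1)[OF a]]] by blast
      show ?thesis
        using v nat[OF V W f a v(1)] rep_homD(3)[OF f \<psi>[OF vs(1)[OF a]]] vs[OF a]
        by (simp add: act[OF V a] act[OF W a] map[OF V W f] hc[OF V a])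
    qed
  qed
  have eq: "f = g" if f: "f \<in> rep_hom K R (FObj F V) B" and g: "g \<in> rep_hom K R (FObj F V) B"
    and V: "is_rep K Q V"
    and fg: "\<And>z v. z \<in> verts R \<Longrightarrow> v \<in> carrier (space V (\<psi> z)) \<Longrightarrow> f z (e V z v) = g z (e V z v)"
    for f g V B
  proof (rule rep_hom_eqI[OF f g])
    fix z w assume z: "z \<in> verts R" and w: "w \<in> carrier (space (FObj F V) z)"
    then obtain v where "v \<in> carrier (space V (\<psi> z))" "w = e V z v"
      using lin_isoD(4)[OF e[OF V z]] by blast
    then show "f z w = g z w" using fg[OF z] by simp
  qed
  note catQ = is_category_rep_cat[OF Q, of K] and catR = is_category_rep_cat[OF R, of K]
  have "is_functor (rep_cat K Q) (rep_cat K R) F"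
    unfolding is_functor_def
  proof (intro conjI catQ catR ballI, goal_cases)
    case 1 then show ?case using obj by (simp add: rep_cat_def)
  next
    case 2 then show ?case using mor by (simp add: rep_cat_def)
  next
    case (3 V)
    then have V: "is_rep K Q V" by (simp add: rep_cat_def)
    have id: "Idn (rep_cat K Q) V \<in> rep_hom K Q V V"
      "Idn (rep_cat K R) (FObj F V) \<in> rep_hom K R (FObj F V) (FObj F V)"
      using catQ catR V obj[OF V] unfolding is_category_def by (auto simp: rep_cat_def)
    show ?case
    proof (rule eq[OF mor[OF V V id(1)] id(2) V])
      fix z v assume z: "z \<in> verts R" and v: "v \<in> carrier (space V (\<psi> z))"
      show "FMap F V V (Idn (rep_cat K Q) V) z (e V z v) = Idn (rep_cat K R) (FObj F V) z (e V z v)"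
        using map[OF V V id(1) z v] z v \<psi>[OF z] lin_isoD(6)[OF e[OF V z] v]
        by (simp add: rep_cat_def)
    qed
  next
    case (4 U V W f g)
    then have U: "is_rep K Q U" and V: "is_rep K Q V" and W: "is_rep K Q W"
      and f: "f \<in> rep_hom K Q U V" and g: "g \<in> rep_hom K Q V W" by (auto simp: rep_cat_def)
    have gf: "Cmp (rep_cat K Q) U V W g f \<in> rep_hom K Q U W"
      using catQ U V W f g unfolding is_category_def by (auto simp: rep_cat_def)
    have Fgf: "Cmp (rep_cat K R) (FObj F U) (FObj F V) (FObj F W) (FMap F V W g) (FMap F U V f)
        \<in> rep_hom K R (FObj F U) (FObj F W)"
      using catR obj[OF U] obj[OF V] obj[OF W] mor[OF U V f] mor[OF V W g]
      unfolding is_category_def by (auto simp: rep_cat_def)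
    show ?case
    proof (rule eq[OF mor[OF U W gf] Fgf U])
      fix z v assume z: "z \<in> verts R" and v: "v \<in> carrier (space U (\<psi> z))"
      show "FMap F U W (Cmp (rep_cat K Q) U V W g f) z (e U z v) =
        Cmp (rep_cat K R) (FObj F U) (FObj F V) (FObj F W) (FMap F V W g) (FMap F U V f) z (e U z v)"
        using map[OF U W gf z v] map[OF U V f z v] map[OF V W g z] z v \<psi>[OF z]
          lin_isoD(6)[OF e[OF U z] v] rep_homD(3)[OF f \<psi>[OF z] v]
        by (simp add: rep_cat_def)
    qed
  qed
  then show ?thesis
    unfolding restricts_along_def using \<psi> e hc act map by blast
qed

text \<open>The structure map of the composite at an arrow is what \<open>h'\<close> becomes when it is moved along \<open>e\<close>.
  It is not determined by \<open>h\<close> and \<open>h'\<close> alone, since \<open>h'\<close> uses all of \<open>F V\<close>; hence the parameter \<open>h''\<close>.\<close>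

lemma restricts_along_comp:
  assumes F: "restricts_along K Q R F \<psi> h e" and G: "restricts_along K R T G \<psi>' h' e'"
    and T: "well_formed_quiver T"
    and h'': "\<And>V z z' v. is_rep K Q V \<Longrightarrow> (z, z') \<in> arrows T \<Longrightarrow> v \<in> carrier (space V (\<psi> (\<psi>' z))) \<Longrightarrow>
       h'' V z z' v \<in> carrier (space V (\<psi> (\<psi>' z'))) \<and>
       h' (FObj F V) z z' (e V (\<psi>' z) v) = e V (\<psi>' z') (h'' V z z' v)"
  shows "restricts_along K Q T (G \<circ>\<^sub>F F) (\<lambda>z. \<psi> (\<psi>' z)) h'' (\<lambda>V z v. e' (FObj F V) z (e V (\<psi>' z) v))"
proof -
  have vs: "x \<in> verts T" "y \<in> verts T" if "(x, y) \<in> arrows T" for x y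
    using T that by (auto simp: well_formed_quiver_def)
  note \<psi> = restricts_alongD(2)[OF F] and obj = restricts_alongD(3)[OF F]
    and mor = restricts_alongD(4)[OF F] and e = restricts_alongD(5)[OF F]
    and map = restricts_alongD(8)[OF F]
  note \<psi>' = restricts_alongD(2)[OF G] and e' = restricts_alongD(5)[OF G]
    and act' = restricts_alongD(7)[OF G] and map' = restricts_alongD(8)[OF G]
  have "is_functor (rep_cat K Q) (rep_cat K T) (G \<circ>\<^sub>F F)"
    using restricts_alongD(1)[OF F] restricts_alongD(1)[OF G] by (rule is_functor_comp)
  moreover have "(\<lambda>v. e' (FObj F V) z (e V (\<psi>' z) v)) \<in>
      lin_iso K (space V (\<psi> (\<psi>' z))) (space (FObj (G \<circ>\<^sub>F F) V) z)"
    if "is_rep K Q V" "z \<in> verts T" for V z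
    using lin_iso_comp[OF e[OF that(1) \<psi>'[OF that(2)]] e'[OF obj[OF that(1)] that(2)]]
    by (simp add: comp_functor_def)
  moreover have "act (FObj (G \<circ>\<^sub>F F) V) z z' (e' (FObj F V) z (e V (\<psi>' z) v)) =
      e' (FObj F V) z' (e V (\<psi>' z') (h'' V z z' v))"
    if "is_rep K Q V" "(z, z') \<in> arrows T" "v \<in> carrier (space V (\<psi> (\<psi>' z)))" for V z z' v
    using h''[OF that] act'[OF obj[OF that(1)] that(2)] that lin_isoD(6)[OF e[OF that(1) \<psi>'[OF vs(1)[OF that(2)]]] that(3)]
    by (simp add: comp_functor_def)
  moreover have "FMap (G \<circ>\<^sub>F F) V W f z (e' (FObj F V) z (e V (\<psi>' z) v)) =
      e' (FObj F W) z (e W (\<psi>' z) (f (\<psi> (\<psi>' z)) v))"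
    if "is_rep K Q V" "is_rep K Q W" "f \<in> rep_hom K Q V W" "z \<in> verts T" "v \<in> carrier (space V (\<psi> (\<psi>' z)))"
    for V W f z v
    using map'[OF obj[OF that(1)] obj[OF that(2)] mor[OF that(1-3)] that(4)]
      lin_isoD(6)[OF e[OF that(1) \<psi>'[OF that(4)]] that(5)] map[OF that(1-3) \<psi>'[OF that(4)] that(5)]
    by (simp add: comp_functor_def)
  ultimately show ?thesis
    unfolding restricts_along_def using h'' \<psi> \<psi>' by blast
qed

lemma is_iso_rep_cat_lin_iso:
  assumes R: "well_formed_quiver R" and A: "is_rep K R A" and B: "is_rep K R B"
    and f: "f \<in> rep_hom K R A B"
    and iso: "\<And>z. z \<in> verts R \<Longrightarrow> f z \<in> lin_iso K (space A z) (space B z)"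
  shows "is_iso (rep_cat K R) A B f"
proof -
  have vs: "x \<in> verts R" "y \<in> verts R" if "(x, y) \<in> arrows R" for x y
    using R that by (auto simp: well_formed_quiver_def)
  define g where "g = (\<lambda>z\<in>verts R. \<lambda>w\<in>carrier (space B z). inv_into (carrier (space A z)) (f z) w)"
  have inv: "inv_into (carrier (space A z)) (f z) \<in> lin_iso K (space B z) (space A z)"
    if "z \<in> verts R" for z
    using lin_iso_inv[OF iso[OF that]] is_repD(2)[OF A that] by blast
  have fg: "f z (g z w) = w" "g z w \<in> carrier (space A z)"
    if "z \<in> verts R" "w \<in> carrier (space B z)" for z w
    using that lin_isoD(4)[OF iso[OF that(1)]] lin_isoD(6)[OF inv[OF that(1)] that(2)]
    by (auto simp: g_def f_inv_into_f)
  have gf: "g z (f z v) = v" if "z \<in> verts R" "v \<in> carrier (space A z)" for z v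
    using that lin_isoD(3,6)[OF iso[OF that(1)]] by (auto simp: g_def)
  have "g \<in> rep_hom K R B A"
  proof (rule rep_homI)
    show "g z \<in> module_hom K (space B z) (space A z)" if "z \<in> verts R" for z
      using module_hom_cong[OF lin_isoD(1)[OF inv[OF that]], of "g z"] is_repD(2)[OF B that] that
      by (simp add: g_def)
    show "g z' (act B z z' w) = act A z z' (g z w)"
      if a: "(z, z') \<in> arrows R" and w: "w \<in> carrier (space B z)" for z z' w
    proof -
      have "act B z z' w = f z' (act A z z' (g z w))"
        using rep_hom_act[OF f a, of "g z w"] fg[OF vs(1)[OF a] w] by simp
      then show ?thesis using gf vs[OF a] is_repD(5)[OF A a] fg[OF vs(1)[OF a] w] by simp
    qed
  qed (auto simp: g_def)
  then show ?thesis
    unfolding is_iso_def rep_cat_def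
    using f fg gf rep_homD(3)[OF f]
    by (auto intro!: bexI[of _ g] restrict_ext)
qed

text \<open>
  The comparison map at a vertex \<open>z\<close> is the inverse of \<open>e V z\<close> followed by \<open>e' V z\<close>, that is, the zigzag
  \<open>(F V)(z) \<leftarrow> V(\<psi> z) \<rightarrow> (G V)(z)\<close>.
\<close>

lemma naturally_isomorphic_if_restrict_alike:
  assumes F: "restricts_along K Q R F \<psi> h e" and G: "restricts_along K Q R G \<psi>' h' e'"
    and R: "well_formed_quiver R"
    and \<psi>: "\<And>z. z \<in> verts R \<Longrightarrow> \<psi>' z = \<psi> z"
    and h: "\<And>V z z' v. is_rep K Q V \<Longrightarrow> (z, z') \<in> arrows R \<Longrightarrow> v \<in> carrier (space V (\<psi> z)) \<Longrightarrow>
      h' V z z' v = h V z z' v"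
  shows "naturally_isomorphic (rep_cat K Q) (rep_cat K R) F G"
proof -
  have vs: "x \<in> verts R" "y \<in> verts R" if "(x, y) \<in> arrows R" for x y
    using R that by (auto simp: well_formed_quiver_def)
  note func = restricts_alongD(1)[OF F] restricts_alongD(1)[OF G]
    and \<psi>Q = restricts_alongD(2)[OF F]
    and obj = restricts_alongD(3)[OF F] restricts_alongD(3)[OF G]
    and mor = restricts_alongD(4)[OF F] and e = restricts_alongD(5)[OF F]
  have e': "e' V z \<in> lin_iso K (space V (\<psi> z)) (space (FObj G V) z)" if "is_rep K Q V" "z \<in> verts R" for V z
    using restricts_alongD(5)[OF G that] \<psi>[OF that(2)] by simp
  have act: "act (FObj F V) z z' (e V z v) = e V z' (h V z z' v)"
      "act (FObj G V) z z' (e' V z v) = e' V z' (h V z z' v)"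
      "h V z z' v \<in> carrier (space V (\<psi> z'))"
    if "is_rep K Q V" "(z, z') \<in> arrows R" "v \<in> carrier (space V (\<psi> z))" for V z z' v
    using restricts_alongD(6,7)[OF F that] restricts_alongD(7)[OF G that(1,2), of v]
      \<psi>[OF vs(1)[OF that(2)]] h[OF that] that(3) by simp_all
  have map: "FMap F V W f z (e V z v) = e W z (f (\<psi> z) v)"
      "FMap G V W f z (e' V z v) = e' W z (f (\<psi> z) v)"
    if "is_rep K Q V" "is_rep K Q W" "f \<in> rep_hom K Q V W" "z \<in> verts R" "v \<in> carrier (space V (\<psi> z))"
    for V W f z v
    using restricts_alongD(8)[OF F that] restricts_alongD(8)[OF G that(1-4), of v] \<psi>[OF that(4)] that(5)
    by simp_all
  define \<eta> where "\<eta> V = (\<lambda>z\<in>verts R. \<lambda>w\<in>carrier (space (FObj F V) z).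
      e' V z (inv_into (carrier (space V (\<psi> z))) (e V z) w))" for V
  have \<eta>: "\<eta> V z (e V z v) = e' V z v" if "is_rep K Q V" "z \<in> verts R" "v \<in> carrier (space V (\<psi> z))" for V z v
    using that lin_isoD(3,6)[OF e[OF that(1,2)]] by (simp add: \<eta>_def)
  have iso: "\<eta> V z \<in> lin_iso K (space (FObj F V) z) (space (FObj G V) z)"
    if V: "is_rep K Q V" and z: "z \<in> verts R" for V z
  proof -
    interpret module K "space (FObj F V) z" by (rule is_repD(2)[OF obj(1)[OF V] z])
    have "(\<lambda>w. e' V z (inv_into (carrier (space V (\<psi> z))) (e V z) w)) \<in>
        lin_iso K (space (FObj F V) z) (space (FObj G V) z)"
      using lin_iso_comp[OF lin_iso_inv[OF e[OF V z]] e'[OF V z]] is_repD(2)[OF V \<psi>Q[OF z]] by blast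
    moreover have "bij_betw (restrict g (carrier (space (FObj F V) z)))
         (carrier (space (FObj F V) z)) B = bij_betw g (carrier (space (FObj F V) z)) B" for g B
      by (rule bij_betw_cong) simp
    ultimately show ?thesis
      using z unfolding lin_iso_def \<eta>_def by (auto simp: module_hom_def)
  qed
  have \<eta>_hom: "\<eta> V \<in> rep_hom K R (FObj F V) (FObj G V)" if V: "is_rep K Q V" for V
  proof (rule rep_homI)
    show "\<eta> V z \<in> module_hom K (space (FObj F V) z) (space (FObj G V) z)" if "z \<in> verts R" for z
      using iso[OF V that] by (rule lin_isoD(1))
    show "\<eta> V z' (act (FObj F V) z z' w) = act (FObj G V) z z' (\<eta> V z w)"
      if a: "(z, z') \<in> arrows R" and w: "w \<in> carrier (space (FObj F V) z)" for z z' w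
    proof -
      obtain v where v: "v \<in> carrier (space V (\<psi> z))" "w = e V z v"
        using w lin_isoD(4)[OF e[OF V vs(1)[OF a]]] by blast
      then show ?thesis using act[OF V a v(1)] \<eta> V vs[OF a] by simp
    qed
  qed (auto simp: \<eta>_def)
  have "is_natural_iso (rep_cat K Q) (rep_cat K R) F G \<eta>"
    unfolding is_natural_iso_def
  proof (intro conjI func ballI)
    show "is_iso (rep_cat K R) (FObj F V) (FObj G V) (\<eta> V)" if "V \<in> Obj (rep_cat K Q)" for V
      using that is_iso_rep_cat_lin_iso[OF R _ _ \<eta>_hom iso] obj by (simp add: rep_cat_def)
    show "Cmp (rep_cat K R) (FObj F V) (FObj F W) (FObj G W) (\<eta> W) (FMap F V W f) =
      Cmp (rep_cat K R) (FObj F V) (FObj G V) (FObj G W) (FMap G V W f) (\<eta> V)"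
      if "V \<in> Obj (rep_cat K Q)" "W \<in> Obj (rep_cat K Q)" "f \<in> Hom (rep_cat K Q) V W" for V W f
    proof -
      have V: "is_rep K Q V" and W: "is_rep K Q W" and f: "f \<in> rep_hom K Q V W"
        using that by (auto simp: rep_cat_def)
      have "\<eta> W z (FMap F V W f z w) = FMap G V W f z (\<eta> V z w)"
        if z: "z \<in> verts R" and w: "w \<in> carrier (space (FObj F V) z)" for z w
      proof -
        obtain v where v: "v \<in> carrier (space V (\<psi> z))" "w = e V z v"
          using w lin_isoD(4)[OF e[OF V z]] by blast
        then show ?thesis
          using map[OF V W f z v(1)] \<eta>[OF V z v(1)] \<eta>[OF W z] rep_homD(3)[OF f \<psi>Q[OF z]] by simp
      qed
      then show ?thesis by (auto simp: rep_cat_def intro!: restrict_ext)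
    qed
  qed
  then show ?thesis unfolding naturally_isomorphic_def by blast
qed


section \<open>Linear maps out of free spaces and their quotients\<close>

lemma free_space_simps [simp]:
  "zero (free_space K X) = (\<lambda>_. \<zero>\<^bsub>K\<^esub>)"
  "add (free_space K X) = (\<lambda>f g x. f x \<oplus>\<^bsub>K\<^esub> g x)"
  "smult (free_space K X) = (\<lambda>c f x. c \<otimes>\<^bsub>K\<^esub> f x)"
  by (simp_all add: free_space_def)

lemma free_space_carrier:
  "f \<in> carrier (free_space K X) \<longleftrightarrow>
     (\<forall>x. f x \<in> carrier K) \<and> (\<forall>x. x \<notin> X \<longrightarrow> f x = \<zero>\<^bsub>K\<^esub>) \<and> finite {x. f x \<noteq> \<zero>\<^bsub>K\<^esub>}"
  by (simp add: free_space_def)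

context cring
begin

lemma free_space_closed:
  assumes "f \<in> carrier (free_space R X)" "g \<in> carrier (free_space R X)"
  shows "(\<lambda>x. f x \<oplus> g x) \<in> carrier (free_space R X)"
proof -
  have "{x. f x \<oplus> g x \<noteq> \<zero>} \<subseteq> {x. f x \<noteq> \<zero>} \<union> {x. g x \<noteq> \<zero>}" by auto
  then show ?thesis using assms by (auto simp: free_space_carrier intro: finite_subset)
qed

lemma free_space_smult_closed:
  assumes "c \<in> carrier R" "f \<in> carrier (free_space R X)"
  shows "(\<lambda>x. c \<otimes> f x) \<in> carrier (free_space R X)"
proof -
  have "{x. c \<otimes> f x \<noteq> \<zero>} \<subseteq> {x. f x \<noteq> \<zero>}" using assms(1) by auto
  then show ?thesis using assms by (auto simp: free_space_carrier intro: finite_subset)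
qed

lemma module_free_space: "module R (free_space R X)"
proof (rule moduleI)
  show "abelian_group (free_space R X)"
  proof (rule abelian_groupI)
    show "\<exists>g\<in>carrier (free_space R X). g \<oplus>\<^bsub>free_space R X\<^esub> f = \<zero>\<^bsub>free_space R X\<^esub>"
      if f: "f \<in> carrier (free_space R X)" for f
    proof (intro bexI[of _ "\<lambda>x. \<ominus> f x"])
      have "{x. \<ominus> f x \<noteq> \<zero>} \<subseteq> {x. f x \<noteq> \<zero>}" by auto
      then show "(\<lambda>x. \<ominus> f x) \<in> carrier (free_space R X)"
        using f by (auto simp: free_space_carrier intro: finite_subset)
      show "(\<lambda>x. \<ominus> f x) \<oplus>\<^bsub>free_space R X\<^esub> f = \<zero>\<^bsub>free_space R X\<^esub>"
        using f by (auto simp: free_space_carrier l_neg)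
    qed
  qed (auto simp: free_space_closed, auto simp: free_space_carrier a_ac fun_eq_iff)
qed (auto simp: is_cring free_space_smult_closed,
     auto simp: free_space_carrier fun_eq_iff l_distr r_distr m_assoc)

lemma basis_vec_closed: "x \<in> X \<Longrightarrow> basis_vec R x \<in> carrier (free_space R X)"
  by (auto simp: free_space_carrier basis_vec_def)

lemma free_space_upd_closed:
  assumes "f \<in> carrier (free_space R X)" "x \<in> X" "c \<in> carrier R"
  shows "f(x := c) \<in> carrier (free_space R X)"
proof -
  have "{y. (f(x := c)) y \<noteq> \<zero>} \<subseteq> insert x {y. f y \<noteq> \<zero>}" by auto
  then have "finite {y. (f(x := c)) y \<noteq> \<zero>}"
    by (rule finite_subset) (use assms(1) in \<open>simp add: free_space_carrier\<close>)
  then show ?thesis using assms by (auto simp: free_space_carrier)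
qed

text \<open>
  The value is set at a point outside the support, so that in applications the support grows by that
  point and no cancellation has to be considered.
\<close>

lemma free_space_induct [consumes 1, case_names zero upd]:
  assumes f: "f \<in> carrier (free_space R X)"
    and zero: "P (\<lambda>_. \<zero>)"
    and upd: "\<And>f x c. f \<in> carrier (free_space R X) \<Longrightarrow> x \<in> X \<Longrightarrow> f x = \<zero> \<Longrightarrow>
      c \<in> carrier R \<Longrightarrow> P f \<Longrightarrow> P (f(x := c))"
  shows "P f"
proof -
  have "finite A \<Longrightarrow> f \<in> carrier (free_space R X) \<Longrightarrow> {x. f x \<noteq> \<zero>} = A \<Longrightarrow> P f" for A
  proof (induction A arbitrary: f rule: finite_induct)
    case empty
    then have "f = (\<lambda>_. \<zero>)" by auto
    then show ?case using zero by simp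
  next
    case (insert x A)
    let ?f = "f(x := \<zero>)"
    have x: "x \<in> X" using insert by (auto simp: free_space_carrier)
    have "{y. ?f y \<noteq> \<zero>} = A" using insert by auto
    then have "P ?f" by (intro insert.IH free_space_upd_closed[OF insert.prems(1) x]) auto
    then have "P (?f(x := f x))"
      using upd[of ?f x "f x"] free_space_upd_closed[OF insert.prems(1) x] x insert.prems(1)
      by (simp add: free_space_carrier)
    then show ?case by simp
  qed
  from this[of "{x. f x \<noteq> \<zero>}"] show ?thesis using f by (simp add: free_space_carrier)
qed

lemma free_space_upd:
  assumes "f \<in> carrier (free_space R X)" "f x = \<zero>" "c \<in> carrier R"
  shows "f(x := c) = f \<oplus>\<^bsub>free_space R X\<^esub> (c \<odot>\<^bsub>free_space R X\<^esub> basis_vec R x)"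
  using assms by (auto simp: fun_eq_iff basis_vec_def free_space_carrier)

end

definition lin_ext :: "('k, 'z) ring_scheme \<Rightarrow> ('k, 'w, 'y) module_scheme \<Rightarrow> ('x \<Rightarrow> 'w) \<Rightarrow> ('x \<Rightarrow> 'k) \<Rightarrow> 'w" where
  "lin_ext K W g f = finsum W (\<lambda>x. f x \<odot>\<^bsub>W\<^esub> g x) {x. f x \<noteq> \<zero>\<^bsub>K\<^esub>}"

context module
begin

text \<open>The sum in \<open>lin_ext\<close> runs over the support, which changes under addition; additivity is proved on a
  common larger index set.\<close>

lemma lin_ext_superset:
  assumes f: "f \<in> carrier (free_space R X)" and g: "g \<in> X \<rightarrow> carrier M"
    and A: "finite A" "{x. f x \<noteq> \<zero>} \<subseteq> A" "A \<subseteq> X"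
  shows "lin_ext R M g f = finsum M (\<lambda>x. f x \<odot>\<^bsub>M\<^esub> g x) A"
  unfolding lin_ext_def
  by (rule M.add.finprod_mono_neutral_cong_left)
    (use assms in \<open>auto simp: free_space_carrier Pi_def\<close>)

lemma lin_ext_module_hom:
  assumes g: "g \<in> X \<rightarrow> carrier M"
  shows "lin_ext R M g \<in> module_hom R (free_space R X) M"
proof -
  have closed: "lin_ext R M g f \<in> carrier M" if "f \<in> carrier (free_space R X)" for f
    unfolding lin_ext_def
    by (rule M.finsum_closed) (use that g in \<open>auto simp: free_space_carrier Pi_def\<close>)
  moreover have "lin_ext R M g (\<lambda>x. f x \<oplus> f' x) = lin_ext R M g f \<oplus>\<^bsub>M\<^esub> lin_ext R M g f'"
    if f: "f \<in> carrier (free_space R X)" and f': "f' \<in> carrier (free_space R X)" for f f'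
  proof -
    let ?A = "{x. f x \<noteq> \<zero>} \<union> {x. f' x \<noteq> \<zero>}"
    have A: "finite ?A" "?A \<subseteq> X" using f f' by (auto simp: free_space_carrier)
    have c: "f x \<in> carrier R" "f' x \<in> carrier R" for x using f f' by (auto simp: free_space_carrier)
    have gA: "g x \<in> carrier M" if "x \<in> ?A" for x using A g that by auto
    have "lin_ext R M g (\<lambda>x. f x \<oplus> f' x) = finsum M (\<lambda>x. (f x \<oplus> f' x) \<odot>\<^bsub>M\<^esub> g x) ?A"
      by (rule lin_ext_superset[OF R.free_space_closed[OF f f'] g A(1) _ A(2)]) auto
    also have "\<dots> = finsum M (\<lambda>x. f x \<odot>\<^bsub>M\<^esub> g x \<oplus>\<^bsub>M\<^esub> f' x \<odot>\<^bsub>M\<^esub> g x) ?A"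
      by (rule M.finsum_cong') (use c gA in \<open>auto simp: smult_l_distr\<close>)
    also have "\<dots> = finsum M (\<lambda>x. f x \<odot>\<^bsub>M\<^esub> g x) ?A \<oplus>\<^bsub>M\<^esub> finsum M (\<lambda>x. f' x \<odot>\<^bsub>M\<^esub> g x) ?A"
      by (rule M.finsum_addf) (use c gA in \<open>auto simp: Pi_def\<close>)
    also have "\<dots> = lin_ext R M g f \<oplus>\<^bsub>M\<^esub> lin_ext R M g f'"
      by (simp add: lin_ext_superset[OF f g A(1) _ A(2)] lin_ext_superset[OF f' g A(1) _ A(2)])
    finally show ?thesis .
  qed
  moreover have "lin_ext R M g (\<lambda>x. c \<otimes> f x) = c \<odot>\<^bsub>M\<^esub> lin_ext R M g f"
    if cK: "c \<in> carrier R" and f: "f \<in> carrier (free_space R X)" for c f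
  proof -
    let ?A = "{x. f x \<noteq> \<zero>}"
    have A: "finite ?A" "?A \<subseteq> X" using f by (auto simp: free_space_carrier)
    have c: "f x \<in> carrier R" for x using f by (auto simp: free_space_carrier)
    have gA: "g x \<in> carrier M" if "x \<in> ?A" for x using A g that by auto
    have "lin_ext R M g (\<lambda>x. c \<otimes> f x) = finsum M (\<lambda>x. (c \<otimes> f x) \<odot>\<^bsub>M\<^esub> g x) ?A"
      by (rule lin_ext_superset[OF R.free_space_smult_closed[OF cK f] g A(1) _ A(2)]) (use cK in auto)
    also have "\<dots> = finsum M (\<lambda>x. c \<odot>\<^bsub>M\<^esub> (f x \<odot>\<^bsub>M\<^esub> g x)) ?A"
      by (rule M.finsum_cong') (use c cK gA in \<open>auto simp: smult_assoc1\<close>)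
    also have "\<dots> = c \<odot>\<^bsub>M\<^esub> lin_ext R M g f"
      unfolding lin_ext_def
      by (rule finsum_smult[symmetric]) (use c cK gA in \<open>auto simp: Pi_def\<close>)
    finally show ?thesis .
  qed
  ultimately show ?thesis unfolding module_hom_def by auto
qed

lemma lin_ext_basis_vec:
  assumes "g x \<in> carrier M"
  shows "lin_ext R M g (basis_vec R x) = g x"
proof (cases "\<one> = \<zero>")
  case True
  then have "g x = \<zero>\<^bsub>M\<^esub>" using assms smult_one smult_l_null by metis
  moreover have "{y. basis_vec R x y \<noteq> \<zero>} = {}" using True by (auto simp: basis_vec_def)
  ultimately show ?thesis by (simp add: lin_ext_def)
next
  case False
  then have "{y. basis_vec R x y \<noteq> \<zero>} = {x}" by (auto simp: basis_vec_def)
  then show ?thesis using assms by (simp add: lin_ext_def basis_vec_def)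
qed

lemma lin_ext_zero: "lin_ext R M g (\<lambda>_. \<zero>) = \<zero>\<^bsub>M\<^esub>"
  by (simp add: lin_ext_def)

lemma lin_ext_upd:
  assumes "f \<in> carrier (free_space R X)" "g \<in> X \<rightarrow> carrier M" "x \<in> X" "f x = \<zero>" "c \<in> carrier R"
  shows "lin_ext R M g (f(x := c)) = lin_ext R M g f \<oplus>\<^bsub>M\<^esub> c \<odot>\<^bsub>M\<^esub> g x"
proof -
  interpret F: module R "free_space R X" by (rule R.module_free_space)
  note hom = lin_ext_module_hom[OF assms(2)]
  have b: "basis_vec R x \<in> carrier (free_space R X)" using assms(3) by (rule R.basis_vec_closed)
  show ?thesis
    unfolding R.free_space_upd[OF assms(1,4,5)]
    using module_hom_add[OF hom assms(1) F.smult_closed[OF assms(5) b]]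
      module_hom_smult[OF hom assms(5) b] lin_ext_basis_vec[of g x, OF funcset_mem[OF assms(2,3)]] by simp
qed

end

context cring
begin

lemma push_zero: "push R \<phi> (\<lambda>_. \<zero>) = (\<lambda>_. \<zero>)"
  by (simp add: push_def)

lemma push_upd:
  assumes f: "f \<in> carrier (free_space R X)" and x: "f x = \<zero>" and c: "c \<in> carrier R"
  shows "push R \<phi> (f(x := c)) = (\<lambda>y. push R \<phi> f y \<oplus> c \<otimes> basis_vec R (\<phi> x) y)"
proof
  fix y
  have fin: "finite {z. f z \<noteq> \<zero> \<and> \<phi> z = y}" and fc: "f z \<in> carrier R" for z
    using f by (auto simp: free_space_carrier)
  have cl: "push R \<phi> f y \<in> carrier R" unfolding push_def using fc by (auto intro: finsum_closed)
  have cong: "finsum R (f(x := c)) {z. f z \<noteq> \<zero> \<and> \<phi> z = y} = push R \<phi> f y"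
    unfolding push_def by (rule finsum_cong') (use fc x in auto)
  show "push R \<phi> (f(x := c)) y = push R \<phi> f y \<oplus> c \<otimes> basis_vec R (\<phi> x) y"
  proof (cases "\<phi> x = y \<and> c \<noteq> \<zero>")
    case True
    then have "{z. (f(x := c)) z \<noteq> \<zero> \<and> \<phi> z = y} = insert x {z. f z \<noteq> \<zero> \<and> \<phi> z = y}" by auto
    then have "push R \<phi> (f(x := c)) y = c \<oplus> finsum R (f(x := c)) {z. f z \<noteq> \<zero> \<and> \<phi> z = y}"
      unfolding push_def by (simp add: fin x) (subst finsum_insert, use fin fc c x in auto)
    then show ?thesis using True c cl unfolding cong by (simp add: basis_vec_def a_comm)
  next
    case False
    then have "{z. (f(x := c)) z \<noteq> \<zero> \<and> \<phi> z = y} = {z. f z \<noteq> \<zero> \<and> \<phi> z = y}" using x by auto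
    then have "push R \<phi> (f(x := c)) y = finsum R (f(x := c)) {z. f z \<noteq> \<zero> \<and> \<phi> z = y}"
      unfolding push_def by simp
    then show ?thesis using False c cl unfolding cong by (auto simp: basis_vec_def)
  qed
qed

lemma push_closed:
  assumes f: "f \<in> carrier (free_space R X)" and \<phi>: "\<phi> \<in> X \<rightarrow> Y"
  shows "push R \<phi> f \<in> carrier (free_space R Y)"
  using f
proof (induction rule: free_space_induct)
  case zero
  then show ?case by (simp add: push_zero free_space_carrier)
next
  case (upd f x c)
  have "basis_vec R (\<phi> x) \<in> carrier (free_space R Y)"
    using funcset_mem[OF \<phi> upd(2)] by (rule basis_vec_closed)
  then show ?case
    unfolding push_upd[OF upd(1,3,4)]
    using free_space_closed[OF upd.IH free_space_smult_closed[OF upd(4)]] by blast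
qed

end

text \<open>A commutative square on generators extends to the free spaces. This is what identifies the maps
  induced by \<open>tensor_map\<close>.\<close>

lemma lin_ext_push:
  assumes M: "module K M" and N: "module K N" and h: "h \<in> module_hom K M N"
    and g: "g \<in> X \<rightarrow> carrier M" and g': "g' \<in> Y \<rightarrow> carrier N" and \<phi>: "\<phi> \<in> X \<rightarrow> Y"
    and comm: "\<And>x. x \<in> X \<Longrightarrow> g' (\<phi> x) = h (g x)"
    and f: "f \<in> carrier (free_space K X)"
  shows "lin_ext K N g' (push K \<phi> f) = h (lin_ext K M g f)"
proof -
  interpret mod_hom K M N h by (simp add: mod_hom_def mod_hom_axioms_def M N h)
  note g_hom = M.lin_ext_module_hom[OF g] and g'_hom = N.lin_ext_module_hom[OF g']
  from f show ?thesis
  proof (induction rule: M.R.free_space_induct)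
    case zero
    then show ?case by (simp add: M.R.push_zero M.lin_ext_zero N.lin_ext_zero)
  next
    case (upd f x c)
    have b: "basis_vec K (\<phi> x) \<in> carrier (free_space K Y)"
      using funcset_mem[OF \<phi> upd(2)] by (rule M.R.basis_vec_closed)
    have cb: "(\<lambda>y. c \<otimes>\<^bsub>K\<^esub> basis_vec K (\<phi> x) y) \<in> carrier (free_space K Y)"
      by (rule M.R.free_space_smult_closed[OF upd(4) b])
    have "lin_ext K N g' (push K \<phi> (f(x := c))) =
        lin_ext K N g' (push K \<phi> f) \<oplus>\<^bsub>N\<^esub> lin_ext K N g' (\<lambda>y. c \<otimes>\<^bsub>K\<^esub> basis_vec K (\<phi> x) y)"
      using module_hom_add[OF g'_hom M.R.push_closed[OF upd(1) \<phi>] cb]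
      by (simp add: M.R.push_upd[OF upd(1,3,4)])
    also have "lin_ext K N g' (\<lambda>y. c \<otimes>\<^bsub>K\<^esub> basis_vec K (\<phi> x) y) = c \<odot>\<^bsub>N\<^esub> h (g x)"
      using module_hom_smult[OF g'_hom upd(4) b] funcset_mem[OF g' funcset_mem[OF \<phi> upd(2)]]
      by (simp add: N.lin_ext_basis_vec comm[OF upd(2)])
    finally show ?case
      unfolding M.lin_ext_upd[OF upd(1) g upd(2-4)] upd.IH
      using funcset_mem[OF module_hom_closed[OF g_hom] upd(1)] funcset_mem[OF g upd(2)] upd(4) by simp
  qed
qed

text \<open>
  The cosets of the kernel \<open>N\<close> of a surjective linear map \<open>q\<close> are the fibres of \<open>q\<close>. So
  \<open>w \<mapsto> fibre F q w\<close> identifies the codomain with \<open>quot_space F N\<close>: this is the inverse of the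
  isomorphism of the first isomorphism theorem, and through it \<open>quot_space F N\<close> acquires its
  vector space structure.
\<close>

definition fibre :: "('k, 'f) module \<Rightarrow> ('f \<Rightarrow> 'w) \<Rightarrow> 'w \<Rightarrow> 'f set" where
  "fibre F q w = {f \<in> carrier F. q f = w}"

locale quotient_presentation =
  F: module K F + W: module K W
  for K :: "('k, 'z) ring_scheme" and F :: "('k, 'f) module" and W :: "('k, 'w, 'y) module_scheme" +
  fixes q :: "'f \<Rightarrow> 'w" and N :: "'f set"
  assumes q: "q \<in> module_hom K F W"
    and surj: "q ` carrier F = carrier W"
    and N: "N = {f \<in> carrier F. q f = \<zero>\<^bsub>W\<^esub>}"
begin

sublocale q: mod_hom K F W q
  by unfold_locales (rule q)

lemma coset_eq_fibre:
  assumes f: "f \<in> carrier F"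
  shows "N +>\<^bsub>F\<^esub> f = fibre F q (q f)"
proof -
  have "f' \<in> N +>\<^bsub>F\<^esub> f" if f': "f' \<in> carrier F" "q f' = q f" for f'
  proof -
    have "f' = (f' \<ominus>\<^bsub>F\<^esub> f) \<oplus>\<^bsub>F\<^esub> f"
      using f f' by (simp add: F.M.minus_eq F.M.a_assoc F.M.l_neg)
    moreover have "f' \<ominus>\<^bsub>F\<^esub> f \<in> N"
      using f f' by (simp add: N F.M.minus_eq q.f_neg W.M.r_neg)
    ultimately show ?thesis unfolding a_r_coset_def' by blast
  qed
  then show ?thesis using f by (auto simp: fibre_def a_r_coset_def' N)
qed

lemma fibre_lin_iso: "fibre F q \<in> lin_iso K W (quot_space F N)"
proof -
  have ex: "\<exists>f\<in>carrier F. q f = w" if "w \<in> carrier W" for w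
    using that surj by (metis imageE)
  have carrier: "carrier (quot_space F N) = fibre F q ` carrier W"
  proof -
    have "carrier (quot_space F N) = (\<lambda>f. fibre F q (q f)) ` carrier F"
      by (auto simp: quot_space_def A_RCOSETS_def' coset_eq_fibre)
    then show ?thesis by (simp add: surj[symmetric] image_image)
  qed
  have add: "fibre F q (w \<oplus>\<^bsub>W\<^esub> w') = set_add F (fibre F q w) (fibre F q w')"
    if "w \<in> carrier W" "w' \<in> carrier W" for w w'
  proof -
    have "f \<in> set_add F (fibre F q w) (fibre F q w')" if f: "f \<in> fibre F q (w \<oplus>\<^bsub>W\<^esub> w')" for f
    proof -
      obtain g where g: "g \<in> carrier F" "q g = w" using ex \<open>w \<in> carrier W\<close> by blast
      have "f = g \<oplus>\<^bsub>F\<^esub> (f \<ominus>\<^bsub>F\<^esub> g)"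
        using f g(1) by (auto simp: fibre_def F.M.minus_eq F.M.a_lcomm[of g f] F.M.r_neg)
      moreover have "f \<ominus>\<^bsub>F\<^esub> g \<in> fibre F q w'"
        using f g \<open>w' \<in> _\<close> by (auto simp: fibre_def F.M.minus_eq q.f_neg W.M.a_ac W.M.r_neg W.M.r_neg1)
      ultimately show ?thesis using g unfolding set_add_def' fibre_def by blast
    qed
    then show ?thesis by (auto simp: set_add_def' fibre_def)
  qed
  have smult: "fibre F q (c \<odot>\<^bsub>W\<^esub> w) = (\<Union>f\<in>fibre F q w. N +>\<^bsub>F\<^esub> (c \<odot>\<^bsub>F\<^esub> f))"
    if "c \<in> carrier K" "w \<in> carrier W" for c w
  proof -
    have "N +>\<^bsub>F\<^esub> (c \<odot>\<^bsub>F\<^esub> f) = fibre F q (c \<odot>\<^bsub>W\<^esub> w)" if "f \<in> fibre F q w" for f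
      using that \<open>c \<in> carrier K\<close> by (auto simp: coset_eq_fibre fibre_def)
    moreover have "fibre F q w \<noteq> {}" using ex[OF \<open>w \<in> _\<close>] by (auto simp: fibre_def)
    ultimately show ?thesis by simp
  qed
  have "inj_on (fibre F q) (carrier W)"
  proof (rule inj_onI)
    fix w w' assume "w \<in> carrier W" "fibre F q w = fibre F q w'"
    then show "w = w'" using ex[of w] by (auto simp: fibre_def)
  qed
  then show ?thesis
    unfolding lin_iso_def module_hom_def bij_betw_def
    using carrier add smult by (auto simp: quot_space_def N fibre_def)
qed

end


section \<open>Products of linear quivers\<close>

lemma verts_A_quiver:
  "xs \<in> verts (A_quiver ms) \<longleftrightarrow> length xs = length ms \<and> (\<forall>l<length ms. 1 \<le> xs ! l \<and> xs ! l \<le> ms ! l)"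
  by (auto simp: A_quiver_def prod_quiver_def linear_quiver_def Let_def)

lemma arrows_A_quiver:
  "(xs, ys) \<in> arrows (A_quiver ms) \<longleftrightarrow>
     xs \<in> verts (A_quiver ms) \<and> (\<exists>l<length ms. ys = xs[l := Suc (xs ! l)] \<and> Suc (xs ! l) \<le> ms ! l)"
proof -
  have "(x, y) \<in> arrows (linear_quiver m) \<longleftrightarrow> 1 \<le> x \<and> y = Suc x \<and> y \<le> m" for x y m
    by (auto simp: linear_quiver_def)
  moreover have "(xs, ys) \<in> arrows (A_quiver ms) \<longleftrightarrow>
      xs \<in> verts (A_quiver ms) \<and>
      (\<exists>l<length ms. \<exists>y. ys = xs[l := y] \<and> (xs ! l, y) \<in> arrows (linear_quiver (ms ! l)))"
  proof -
    have "arrows (A_quiver ms) = {(xs, xs[l := y]) | xs l y. xs \<in> verts (A_quiver ms) \<and>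
        l < length ms \<and> (xs ! l, y) \<in> arrows (map linear_quiver ms ! l)}"
      by (simp add: A_quiver_def prod_quiver_def Let_def)
    then have "(xs, ys) \<in> arrows (A_quiver ms) \<longleftrightarrow> xs \<in> verts (A_quiver ms) \<and>
        (\<exists>l<length ms. \<exists>y. ys = xs[l := y] \<and> (xs ! l, y) \<in> arrows (map linear_quiver ms ! l))"
      by (simp only: mem_Collect_eq prod.inject) blast
    then show ?thesis by (simp cong: conj_cong)
  qed
  ultimately show ?thesis unfolding verts_A_quiver by auto
qed

lemma well_formed_A_quiver: "well_formed_quiver (A_quiver ms)"
  unfolding well_formed_quiver_def
  by (auto simp: arrows_A_quiver verts_A_quiver nth_list_update)

lemma arrows_A_quiverD:
  assumes "(xs, ys) \<in> arrows (A_quiver ms)"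
  shows "xs \<in> verts (A_quiver ms)" "ys \<in> verts (A_quiver ms)"
  using assms well_formed_A_quiver[of ms] by (auto simp: well_formed_quiver_def)

text \<open>The sum of the coordinates grades a product of linear quivers. It shows that an arrow changes its
  source and counts how many steps of a path lie in a given block of coordinates.\<close>

lemma sum_list_arrow:
  assumes "(xs, ys) \<in> arrows (A_quiver ms)"
  shows "sum_list ys = Suc (sum_list xs)"
proof -
  obtain l where "l < length xs" "ys = xs[l := Suc (xs ! l)]"
    using assms by (auto simp: arrows_A_quiver verts_A_quiver)
  then show ?thesis using member_le_sum_list[of "xs ! l" xs] by (simp add: sum_list_update)
qed

lemma verts_A_quiver_Cons:
  "k # ys \<in> verts (A_quiver (a # ms)) \<longleftrightarrow> 1 \<le> k \<and> k \<le> a \<and> ys \<in> verts (A_quiver ms)"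
  by (auto simp: verts_A_quiver nth_Cons less_Suc_eq_0_disj split: nat.splits)

lemma arrows_A_quiver_Cons:
  "1 \<le> k \<Longrightarrow> k < a \<Longrightarrow> ys \<in> verts (A_quiver ms) \<Longrightarrow> (k # ys, Suc k # ys) \<in> arrows (A_quiver (a # ms))"
  "1 \<le> k \<Longrightarrow> k \<le> a \<Longrightarrow> (ys, ys') \<in> arrows (A_quiver ms) \<Longrightarrow>
     (k # ys, k # ys') \<in> arrows (A_quiver (a # ms))"
  by (auto simp: arrows_A_quiver verts_A_quiver_Cons intro: exI[of _ 0] exI[of _ "Suc l" for l])

lemma verts_A_quiver_append:
  assumes "z \<in> verts (A_quiver (rs @ ms))"
  shows "take (length rs) z \<in> verts (A_quiver rs)" "drop (length rs) z \<in> verts (A_quiver ms)"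
proof -
  have z: "length z = length rs + length ms"
    "\<And>l. l < length rs + length ms \<Longrightarrow> 1 \<le> z ! l \<and> z ! l \<le> (rs @ ms) ! l"
    using assms by (auto simp: verts_A_quiver)
  show "take (length rs) z \<in> verts (A_quiver rs)"
    unfolding verts_A_quiver
  proof (intro conjI allI impI)
    show "length (take (length rs) z) = length rs" using z(1) by simp
    show "1 \<le> take (length rs) z ! l" "take (length rs) z ! l \<le> rs ! l" if "l < length rs" for l
      using z(2)[of l] that by (auto simp: nth_append)
  qed
  show "drop (length rs) z \<in> verts (A_quiver ms)"
    unfolding verts_A_quiver
  proof (intro conjI allI impI)
    show "length (drop (length rs) z) = length ms" using z(1) by simp
    show "1 \<le> drop (length rs) z ! l" "drop (length rs) z ! l \<le> ms ! l" if "l < length ms" for l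
      using z(1) z(2)[of "length rs + l"] that by (auto simp: nth_append)
  qed
qed

lemma arrows_A_quiver_append:
  assumes "(z, z') \<in> arrows (A_quiver (rs @ ms))"
  obtains
    (left) "(take (length rs) z, take (length rs) z') \<in> arrows (A_quiver rs)"
      "drop (length rs) z' = drop (length rs) z" "drop (length rs) z \<in> verts (A_quiver ms)"
  | (right) "take (length rs) z' = take (length rs) z" "take (length rs) z \<in> verts (A_quiver rs)"
      "(drop (length rs) z, drop (length rs) z') \<in> arrows (A_quiver ms)"
proof -
  obtain l where z: "z \<in> verts (A_quiver (rs @ ms))" and l: "l < length rs + length ms"
    "z' = z[l := Suc (z ! l)]" "Suc (z ! l) \<le> (rs @ ms) ! l"
    using assms by (auto simp: arrows_A_quiver)
  have len: "length z = length rs + length ms" using z by (simp add: verts_A_quiver)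
  note zz = verts_A_quiver_append[OF z]
  show thesis
  proof (cases "l < length rs")
    case True
    show thesis
    proof (rule left)
      show "(take (length rs) z, take (length rs) z') \<in> arrows (A_quiver rs)"
        unfolding arrows_A_quiver
        using zz l True len by (auto intro!: exI[of _ l] simp: nth_append take_update_swap)
    qed (use l True zz in auto)
  next
    case False
    show thesis
    proof (rule right)
      show "(drop (length rs) z, drop (length rs) z') \<in> arrows (A_quiver ms)"
        unfolding arrows_A_quiver
        using zz l False len
        by (auto intro!: exI[of _ "l - length rs"] simp: nth_append drop_update_swap)
    qed (use l False zz in auto)
  qed
qed


section \<open>Transport along the first coordinate\<close>

text \<open>The structure map of \<open>V\<close> along the path from \<open>k # ys\<close> to \<open>l # ys\<close>, by recursion on \<open>l\<close>. For
  \<open>l \<le> k\<close> it is the identity.\<close>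

primrec climb :: "(nat list, 'k, 'v) rep \<Rightarrow> nat list \<Rightarrow> nat \<Rightarrow> nat \<Rightarrow> 'v \<Rightarrow> 'v" where
  "climb V ys k 0 v = v"
| "climb V ys k (Suc l) v = (if k \<le> l then act V (l # ys) (Suc l # ys) (climb V ys k l v) else v)"

lemma climb_self [simp]: "l \<le> k \<Longrightarrow> climb V ys k l v = v"
  by (cases l) auto

lemma climb_trans:
  assumes "k \<le> l" "l \<le> t"
  shows "climb V ys l t (climb V ys k l v) = climb V ys k t v"
  using assms(2,1) by (induction t rule: dec_induct) auto

lemma climb_hom:
  assumes V: "is_rep K (A_quiver (a # ms)) V" and ys: "ys \<in> verts (A_quiver ms)"
    and "k \<le> l" "1 \<le> k" "l \<le> a"
  shows "climb V ys k l \<in> module_hom K (space V (k # ys)) (space V (l # ys))"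
  using assms(3-5)
proof (induction l rule: dec_induct)
  case base
  then have "module K (space V (k # ys))"
    using is_repD(2)[OF V] ys by (simp add: verts_A_quiver_Cons)
  then show ?case by (auto simp: module_hom_def)
next
  case (step l)
  have "act V (l # ys) (Suc l # ys) \<in> module_hom K (space V (l # ys)) (space V (Suc l # ys))"
    using is_repD(4)[OF V arrows_A_quiver_Cons(1)[OF _ _ ys]] step by simp
  with module_hom_comp step show ?case by fastforce
qed

lemma climb_closed:
  assumes "is_rep K (A_quiver (a # ms)) V" "ys \<in> verts (A_quiver ms)" "k \<le> l" "1 \<le> k" "l \<le> a"
    and "v \<in> carrier (space V (k # ys))"
  shows "climb V ys k l v \<in> carrier (space V (l # ys))"
  using module_hom_closed[OF climb_hom[OF assms(1-5)]] assms(6) by auto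

lemma climb_act:
  assumes V: "is_rep K (A_quiver (a # ms)) V" and a: "(ys, ys') \<in> arrows (A_quiver ms)"
    and "k \<le> l" "1 \<le> k" "l \<le> a" and v: "v \<in> carrier (space V (k # ys))"
  shows "climb V ys' k l (act V (k # ys) (k # ys') v) = act V (l # ys) (l # ys') (climb V ys k l v)"
  using assms(3-5)
proof (induction l rule: dec_induct)
  case (step l)
  note ys = arrows_A_quiverD[OF a]
  have "act V (l # ys') (Suc l # ys') (act V (l # ys) (l # ys') (climb V ys k l v)) =
      act V (Suc l # ys) (Suc l # ys') (act V (l # ys) (Suc l # ys) (climb V ys k l v))"
    by (rule is_repD(6)[OF V]) (use step ys a in \<open>auto intro!: arrows_A_quiver_Cons climb_closed[OF V] v\<close>)
  then show ?case using step by simp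
qed simp

lemma climb_rep_hom:
  assumes V: "is_rep K (A_quiver (a # ms)) V" and f: "f \<in> rep_hom K (A_quiver (a # ms)) V W"
    and ys: "ys \<in> verts (A_quiver ms)"
    and "k \<le> l" "1 \<le> k" "l \<le> a" and v: "v \<in> carrier (space V (k # ys))"
  shows "f (l # ys) (climb V ys k l v) = climb W ys k l (f (k # ys) v)"
  using assms(4-6)
proof (induction l rule: dec_induct)
  case (step l)
  have "climb V ys k l v \<in> carrier (space V (l # ys))" using climb_closed[OF V ys] step v by simp
  then show ?case
    using step rep_hom_act[OF f arrows_A_quiver_Cons(1)[OF _ _ ys], of l] by simp
qed simp


section \<open>Tensoring with a standard module\<close>

text \<open>
  The defining relations of a tensor product are differences; read as congruences modulo their span
  they can be chained by transitivity.
\<close>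

definition cong_mod :: "('k, 'v, 'z) module_scheme \<Rightarrow> 'v set \<Rightarrow> 'v \<Rightarrow> 'v \<Rightarrow> bool" where
  "cong_mod F N f g \<longleftrightarrow> f \<in> carrier F \<and> g \<in> carrier F \<and> f \<ominus>\<^bsub>F\<^esub> g \<in> N"

context module
begin

context
  fixes N
  assumes N: "submodule R N M"
begin

lemma cong_mod_refl: "f \<in> carrier M \<Longrightarrow> cong_mod M N f f"
  using submodule.zero_closed[OF N] by (simp add: cong_mod_def M.minus_eq M.r_neg)

lemma cong_mod_smult:
  assumes "c \<in> carrier R" "cong_mod M N f g"
  shows "cong_mod M N (c \<odot>\<^bsub>M\<^esub> f) (c \<odot>\<^bsub>M\<^esub> g)"
proof -
  have "c \<odot>\<^bsub>M\<^esub> (f \<ominus>\<^bsub>M\<^esub> g) \<in> N"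
    using assms submodule.smult_closed[OF N] by (simp add: cong_mod_def)
  then show ?thesis
    using assms by (simp add: cong_mod_def M.minus_eq smult_r_distr smult_r_minus)
qed

lemma cong_mod_sym:
  assumes "cong_mod M N f g"
  shows "cong_mod M N g f"
proof -
  have fg: "f \<in> carrier M" "g \<in> carrier M" using assms by (auto simp: cong_mod_def)
  have "(\<ominus> \<one>) \<odot>\<^bsub>M\<^esub> (f \<ominus>\<^bsub>M\<^esub> g) \<in> N"
    using assms submodule.smult_closed[OF N] by (simp add: cong_mod_def)
  also have "(\<ominus> \<one>) \<odot>\<^bsub>M\<^esub> (f \<ominus>\<^bsub>M\<^esub> g) = g \<ominus>\<^bsub>M\<^esub> f"
    using fg by (simp add: M.minus_eq smult_l_minus M.minus_add M.a_comm)
  finally show ?thesis using fg by (simp add: cong_mod_def)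
qed

lemma cong_mod_add:
  assumes "cong_mod M N f g" "cong_mod M N f' g'"
  shows "cong_mod M N (f \<oplus>\<^bsub>M\<^esub> f') (g \<oplus>\<^bsub>M\<^esub> g')"
proof -
  have fg: "f \<in> carrier M" "g \<in> carrier M" "f' \<in> carrier M" "g' \<in> carrier M"
    using assms by (auto simp: cong_mod_def)
  have "(f \<ominus>\<^bsub>M\<^esub> g) \<oplus>\<^bsub>M\<^esub> (f' \<ominus>\<^bsub>M\<^esub> g') \<in> N"
    using assms submodule.m_closed[OF N] by (simp add: cong_mod_def)
  also have "(f \<ominus>\<^bsub>M\<^esub> g) \<oplus>\<^bsub>M\<^esub> (f' \<ominus>\<^bsub>M\<^esub> g') = (f \<oplus>\<^bsub>M\<^esub> f') \<ominus>\<^bsub>M\<^esub> (g \<oplus>\<^bsub>M\<^esub> g')"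
    using fg by (simp add: M.minus_eq M.minus_add M.a_ac)
  finally show ?thesis using fg by (simp add: cong_mod_def)
qed

lemma cong_mod_trans [trans]:
  assumes "cong_mod M N f g" "cong_mod M N g h"
  shows "cong_mod M N f h"
proof -
  have fg: "f \<in> carrier M" "g \<in> carrier M" "h \<in> carrier M"
    using assms by (auto simp: cong_mod_def)
  have "(f \<ominus>\<^bsub>M\<^esub> g) \<oplus>\<^bsub>M\<^esub> (g \<ominus>\<^bsub>M\<^esub> h) \<in> N"
    using assms submodule.m_closed[OF N] by (simp add: cong_mod_def)
  also have "(f \<ominus>\<^bsub>M\<^esub> g) \<oplus>\<^bsub>M\<^esub> (g \<ominus>\<^bsub>M\<^esub> h) = f \<ominus>\<^bsub>M\<^esub> h"
    using fg by (simp add: M.minus_eq M.a_assoc M.l_neg M.r_neg1 M.r_neg2)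
  finally show ?thesis using fg by (simp add: cong_mod_def)
qed

lemma cong_mod_zero: "cong_mod M N f \<zero>\<^bsub>M\<^esub> \<Longrightarrow> f \<in> N"
  using M.minus_equality[of "\<zero>\<^bsub>M\<^esub>" "\<zero>\<^bsub>M\<^esub>"] by (auto simp: cong_mod_def M.minus_eq)

end

end

text \<open>The evaluation \<open>v \<otimes> c \<mapsto> c \<cdot> v\<alpha>\<close>, where \<open>\<alpha>\<close> is the path from \<open>\<gamma>\<close> to \<open>t\<close>. It is the isomorphism
  \<open>V \<otimes> P \<rightarrow> V(t)\<close> for the projective left module \<open>P\<close> that is generated at the vertex \<open>t\<close> and has
  support \<open>{1..t}\<close>. In degree \<open>\<gamma> > t\<close> the module \<open>P\<close> vanishes.\<close>

definition std_eval ::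
  "(nat list, 'k, 'v) rep \<Rightarrow> nat list \<Rightarrow> nat \<Rightarrow> nat \<times> 'v \<times> 'k \<Rightarrow> 'v" where
  "std_eval V ys t = (\<lambda>(\<gamma>, v, c).
     if \<gamma> \<le> t then c \<odot>\<^bsub>space V (t # ys)\<^esub> climb V ys \<gamma> t v else \<zero>\<^bsub>space V (t # ys)\<^esub>)"

text \<open>The left module \<open>M(?, xs)\<close> is assumed to have support \<open>{1..t}\<close>. Arrows of the reversed linear
  quiver act on it towards \<open>1\<close>, so it is generated by its unit in degree \<open>t\<close>, and
  \<open>V \<otimes> M(?, xs)\<close> is \<open>V(t)\<close>; the coordinates \<open>ys\<close> of the other factors are fixed throughout.\<close>

locale std_tensor =
  fixes K :: "('k, 'z) ring_scheme" and a :: nat and ms :: "nat list"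
    and V :: "(nat list, 'k, 'v) rep" and S :: "nat list set" and xs ys :: "nat list" and t :: nat
  assumes K: "field K" and V: "is_rep K (A_quiver (a # ms)) V" and ys: "ys \<in> verts (A_quiver ms)"
    and t: "1 \<le> t" "t \<le> a"
    and S: "\<And>\<gamma>. 1 \<le> \<gamma> \<Longrightarrow> \<gamma> \<le> a \<Longrightarrow> \<gamma> # xs \<in> S \<longleftrightarrow> \<gamma> \<le> t"
begin

abbreviation "M \<equiv> std_module K S"
abbreviation "X \<equiv> tensor_gens a V M xs ys"
abbreviation "F \<equiv> free_space K X"
abbreviation "W \<equiv> space V (t # ys)"
abbreviation "N \<equiv> tensor_null K a V M xs ys"
abbreviation "q \<equiv> lin_ext K W (std_eval V ys t)"
abbreviation "b \<gamma> v c \<equiv> basis_vec K (\<gamma>, v, c)"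

sublocale K: field K by (rule K)

sublocale F: module K F by (rule K.module_free_space)

lemma vert: "1 \<le> \<gamma> \<Longrightarrow> \<gamma> \<le> a \<Longrightarrow> \<gamma> # ys \<in> verts (A_quiver (a # ms))"
  using ys by (simp add: verts_A_quiver_Cons)

sublocale W: module K W by (rule is_repD(2)[OF V vert[OF t]])

lemma gens_iff:
  "(\<gamma>, v, c) \<in> X \<longleftrightarrow> 1 \<le> \<gamma> \<and> \<gamma> \<le> a \<and> v \<in> carrier (space V (\<gamma> # ys)) \<and>
     c \<in> carrier K \<and> (t < \<gamma> \<longrightarrow> c = \<zero>\<^bsub>K\<^esub>)"
  using S[of \<gamma>] by (auto simp: tensor_gens_def std_module_def linear_quiver_def)

lemma std_module_carrier:
  assumes "1 \<le> \<gamma>" "\<gamma> \<le> a"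
  shows "c \<in> carrier (space M (\<gamma> # xs)) \<longleftrightarrow> c \<in> carrier K \<and> (t < \<gamma> \<longrightarrow> c = \<zero>\<^bsub>K\<^esub>)"
  using S[OF assms] by (auto simp: std_module_def)

lemma module_V: "1 \<le> \<gamma> \<Longrightarrow> \<gamma> \<le> a \<Longrightarrow> module K (space V (\<gamma> # ys))"
  by (rule is_repD(2)[OF V vert])

lemma climb_closed_t:
  "1 \<le> \<gamma> \<Longrightarrow> \<gamma> \<le> t \<Longrightarrow> v \<in> carrier (space V (\<gamma> # ys)) \<Longrightarrow> climb V ys \<gamma> t v \<in> carrier W"
  using climb_closed[OF V ys] t by simp

lemma std_eval_funcset: "std_eval V ys t \<in> X \<rightarrow> carrier W"
proof
  fix x assume "x \<in> X"
  then show "std_eval V ys t x \<in> carrier W"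
    by (cases x) (auto simp: gens_iff std_eval_def climb_closed_t)
qed

sublocale q: mod_hom K F W q
  by unfold_locales (rule W.lin_ext_module_hom[OF std_eval_funcset])

lemma b_closed:
  "1 \<le> \<gamma> \<Longrightarrow> \<gamma> \<le> a \<Longrightarrow> v \<in> carrier (space V (\<gamma> # ys)) \<Longrightarrow> c \<in> carrier K \<Longrightarrow>
    (t < \<gamma> \<longrightarrow> c = \<zero>\<^bsub>K\<^esub>) \<Longrightarrow> b \<gamma> v c \<in> carrier F"
  by (rule K.basis_vec_closed) (simp add: gens_iff)

lemma q_b:
  assumes "1 \<le> \<gamma>" "\<gamma> \<le> a" "v \<in> carrier (space V (\<gamma> # ys))" "c \<in> carrier K" "t < \<gamma> \<longrightarrow> c = \<zero>\<^bsub>K\<^esub>"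
  shows "q (b \<gamma> v c) = (if \<gamma> \<le> t then c \<odot>\<^bsub>W\<^esub> climb V ys \<gamma> t v else \<zero>\<^bsub>W\<^esub>)"
proof -
  have "q (b \<gamma> v c) = std_eval V ys t (\<gamma>, v, c)"
    by (rule W.lin_ext_basis_vec) (use std_eval_funcset assms gens_iff in blast)
  then show ?thesis by (simp add: std_eval_def)
qed

lemma q_minus:
  assumes "f \<in> carrier F" "g \<in> carrier F"
  shows "f \<ominus>\<^bsub>F\<^esub> g \<in> {f \<in> carrier F. q f = \<zero>\<^bsub>W\<^esub>} \<longleftrightarrow> q f = q g"
  using assms W.M.minus_equality[of "q f" "\<ominus>\<^bsub>W\<^esub> q g"]
  by (auto simp: F.M.minus_eq q.f_neg W.M.r_neg simp del: free_space_simps)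

lemma std_module_simps [simp]:
  "add (space M x) = add K" "smult (space M x) = monoid.mult K"
  by (simp_all add: std_module_def)

text \<open>
  The families of generating relations in coordinates: an element of \<open>M(\<gamma>, xs)\<close> is a scalar that
  vanishes for \<open>\<gamma> > t\<close>, and \<open>M\<close> acts on the scalars of a balancing relation as the identity.
\<close>

lemma rels_cases:
  assumes "r \<in> tensor_rels K a V M xs ys"
  obtains
    (add_left) \<gamma> v v' c where "1 \<le> \<gamma>" "\<gamma> \<le> a" "v \<in> carrier (space V (\<gamma> # ys))"
      "v' \<in> carrier (space V (\<gamma> # ys))" "c \<in> carrier K" "t < \<gamma> \<longrightarrow> c = \<zero>\<^bsub>K\<^esub>"
      "r = b \<gamma> (v \<oplus>\<^bsub>space V (\<gamma> # ys)\<^esub> v') c \<ominus>\<^bsub>F\<^esub> (b \<gamma> v c \<oplus>\<^bsub>F\<^esub> b \<gamma> v' c)"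
  | (add_right) \<gamma> v c c' where "1 \<le> \<gamma>" "\<gamma> \<le> a" "v \<in> carrier (space V (\<gamma> # ys))"
      "c \<in> carrier K" "t < \<gamma> \<longrightarrow> c = \<zero>\<^bsub>K\<^esub>" "c' \<in> carrier K" "t < \<gamma> \<longrightarrow> c' = \<zero>\<^bsub>K\<^esub>"
      "r = b \<gamma> v (c \<oplus>\<^bsub>K\<^esub> c') \<ominus>\<^bsub>F\<^esub> (b \<gamma> v c \<oplus>\<^bsub>F\<^esub> b \<gamma> v c')"
  | (smult_left) \<gamma> d v c where "1 \<le> \<gamma>" "\<gamma> \<le> a" "d \<in> carrier K" "v \<in> carrier (space V (\<gamma> # ys))"
      "c \<in> carrier K" "t < \<gamma> \<longrightarrow> c = \<zero>\<^bsub>K\<^esub>"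
      "r = b \<gamma> (d \<odot>\<^bsub>space V (\<gamma> # ys)\<^esub> v) c \<ominus>\<^bsub>F\<^esub> (d \<odot>\<^bsub>F\<^esub> b \<gamma> v c)"
  | (smult_right) \<gamma> d v c where "1 \<le> \<gamma>" "\<gamma> \<le> a" "d \<in> carrier K" "v \<in> carrier (space V (\<gamma> # ys))"
      "c \<in> carrier K" "t < \<gamma> \<longrightarrow> c = \<zero>\<^bsub>K\<^esub>"
      "r = b \<gamma> v (d \<otimes>\<^bsub>K\<^esub> c) \<ominus>\<^bsub>F\<^esub> (d \<odot>\<^bsub>F\<^esub> b \<gamma> v c)"
  | (balanced) \<gamma> v c where "1 \<le> \<gamma>" "Suc \<gamma> \<le> a" "v \<in> carrier (space V (\<gamma> # ys))"
      "c \<in> carrier K" "t < Suc \<gamma> \<longrightarrow> c = \<zero>\<^bsub>K\<^esub>"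
      "r = b (Suc \<gamma>) (act V (\<gamma> # ys) (Suc \<gamma> # ys) v) c \<ominus>\<^bsub>F\<^esub> b \<gamma> v c"
proof -
  have G: "\<gamma> \<in> verts (linear_quiver a) \<longleftrightarrow> 1 \<le> \<gamma> \<and> \<gamma> \<le> a" for \<gamma>
    by (auto simp: linear_quiver_def)
  have arr: "(\<gamma>, \<gamma>') \<in> arrows (linear_quiver a) \<longleftrightarrow> 1 \<le> \<gamma> \<and> \<gamma>' = Suc \<gamma> \<and> Suc \<gamma> \<le> a" for \<gamma> \<gamma>'
    by (auto simp: linear_quiver_def)
  have act: "act M (Suc \<gamma> # xs) (\<gamma> # xs) c = c"
    if "1 \<le> \<gamma>" "Suc \<gamma> \<le> a" "c \<in> carrier (space M (Suc \<gamma> # xs))" for \<gamma> c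
    using that S[of \<gamma>] S[of "Suc \<gamma>"] by (auto simp: std_module_def)
  from assms show thesis
    unfolding tensor_rels_def Let_def Un_iff mem_Collect_eq std_module_simps
    apply (elim disjE exE conjE)
        apply (rule add_left; (simp add: G std_module_carrier del: free_space_simps; fail))
       apply (rule add_right; (simp add: G std_module_carrier del: free_space_simps; fail))
      apply (rule smult_left; (simp add: G std_module_carrier del: free_space_simps; fail))
     apply (rule smult_right; (simp add: G std_module_carrier del: free_space_simps; fail))
    apply (rule balanced; (simp add: arr std_module_carrier act del: free_space_simps; fail))
    done
qed

lemma rels_subset_kernel: "tensor_rels K a V M xs ys \<subseteq> {f \<in> carrier F. q f = \<zero>\<^bsub>W\<^esub>}"
proof
  fix r assume "r \<in> tensor_rels K a V M xs ys"
  then show "r \<in> {f \<in> carrier F. q f = \<zero>\<^bsub>W\<^esub>}"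
  proof (cases rule: rels_cases)
    case (add_left \<gamma> v v' c)
    interpret V\<gamma>: module K "space V (\<gamma> # ys)" by (rule module_V) fact+
    have "climb V ys \<gamma> t (v \<oplus>\<^bsub>space V (\<gamma> # ys)\<^esub> v') = climb V ys \<gamma> t v \<oplus>\<^bsub>W\<^esub> climb V ys \<gamma> t v'"
      if "\<gamma> \<le> t"
      using module_hom_add[OF climb_hom[OF V ys]] that add_left t by blast
    with add_left show ?thesis
      by (subst add_left(7), subst q_minus)
        (auto simp: b_closed q_b climb_closed_t W.smult_r_distr simp del: free_space_simps)
  next
    case (add_right \<gamma> v c c')
    then show ?thesis
      by (subst add_right(8), subst q_minus)
        (auto simp: b_closed q_b climb_closed_t W.smult_l_distr simp del: free_space_simps)
  next
    case (smult_left \<gamma> d v c)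
    interpret V\<gamma>: module K "space V (\<gamma> # ys)" by (rule module_V) fact+
    have "climb V ys \<gamma> t (d \<odot>\<^bsub>space V (\<gamma> # ys)\<^esub> v) = d \<odot>\<^bsub>W\<^esub> climb V ys \<gamma> t v" if "\<gamma> \<le> t"
      using module_hom_smult[OF climb_hom[OF V ys]] that smult_left t by blast
    with smult_left show ?thesis
      by (subst smult_left(7), subst q_minus)
        (auto simp: b_closed q_b climb_closed_t W.smult_assoc1[symmetric] K.m_comm simp del: free_space_simps)
  next
    case (smult_right \<gamma> d v c)
    then show ?thesis
      by (subst smult_right(7), subst q_minus)
        (auto simp: b_closed q_b climb_closed_t W.smult_assoc1 simp del: free_space_simps)
  next
    case (balanced \<gamma> v c)
    have v': "act V (\<gamma> # ys) (Suc \<gamma> # ys) v \<in> carrier (space V (Suc \<gamma> # ys))"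
      using is_repD(5)[OF V arrows_A_quiver_Cons(1)[OF _ _ ys]] balanced by simp
    have "climb V ys (Suc \<gamma>) t (act V (\<gamma> # ys) (Suc \<gamma> # ys) v) = climb V ys \<gamma> t v" if "Suc \<gamma> \<le> t"
      using climb_trans[of \<gamma> "Suc \<gamma>" t V ys v] that by simp
    moreover have "v \<in> carrier W" if "\<not> Suc \<gamma> \<le> t" "\<gamma> \<le> t"
      using that balanced(3) by (simp add: le_antisym not_less_eq_eq)
    moreover have "\<not> Suc \<gamma> \<le> t \<Longrightarrow> c = \<zero>\<^bsub>K\<^esub>" using balanced by simp
    ultimately show ?thesis
      using balanced v'
      by (subst balanced(6), subst q_minus)
        (auto simp: b_closed q_b climb_closed_t simp del: free_space_simps)
  qed
qed

lemma rels_subset_carrier: "tensor_rels K a V M xs ys \<subseteq> carrier F"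
  using rels_subset_kernel by blast

lemma N_submodule: "submodule K N F"
  unfolding tensor_null_def by (rule F.span_is_submodule[OF rels_subset_carrier])

lemma rels_subset_N: "tensor_rels K a V M xs ys \<subseteq> N"
  unfolding tensor_null_def by (rule F.in_own_span[OF rels_subset_carrier])

lemma N_subset_kernel: "N \<subseteq> {f \<in> carrier F. q f = \<zero>\<^bsub>W\<^esub>}"
proof -
  have "submodule K {f \<in> carrier F. q f = \<zero>\<^bsub>W\<^esub>} F"
    using q.ker_is_submodule by (simp add: q.ker_def)
  then show ?thesis unfolding tensor_null_def by (rule F.span_is_subset[OF rels_subset_kernel])
qed

lemmas N_refl = F.cong_mod_refl[OF N_submodule] and N_sym = F.cong_mod_sym[OF N_submodule]
  and N_trans = F.cong_mod_trans[OF N_submodule] and N_add = F.cong_mod_add[OF N_submodule]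
  and N_smult = F.cong_mod_smult[OF N_submodule]

abbreviation cong_N (infix "\<approx>" 50) where "f \<approx> g \<equiv> cong_mod F N f g"

lemma cong_NI:
  "f \<ominus>\<^bsub>F\<^esub> g \<in> tensor_rels K a V M xs ys \<Longrightarrow> f \<in> carrier F \<Longrightarrow> g \<in> carrier F \<Longrightarrow> f \<approx> g"
  using rels_subset_N by (auto simp: cong_mod_def)

lemma in_verts: "\<gamma> \<in> verts (linear_quiver a) \<longleftrightarrow> 1 \<le> \<gamma> \<and> \<gamma> \<le> a"
  by (auto simp: linear_quiver_def)

lemma b_add_left:
  assumes "1 \<le> \<gamma>" "\<gamma> \<le> t" "v \<in> carrier (space V (\<gamma> # ys))" "v' \<in> carrier (space V (\<gamma> # ys))"
    "c \<in> carrier K"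
  shows "b \<gamma> (v \<oplus>\<^bsub>space V (\<gamma> # ys)\<^esub> v') c \<approx> b \<gamma> v c \<oplus>\<^bsub>F\<^esub> b \<gamma> v' c"
proof -
  have \<gamma>: "\<gamma> \<le> a" using assms t by simp
  interpret V\<gamma>: module K "space V (\<gamma> # ys)" by (rule module_V) fact+
  have "c \<in> carrier (space M (\<gamma> # xs))" using assms \<gamma> by (simp add: std_module_carrier)
  then have "b \<gamma> (v \<oplus>\<^bsub>space V (\<gamma> # ys)\<^esub> v') c \<ominus>\<^bsub>F\<^esub> (b \<gamma> v c \<oplus>\<^bsub>F\<^esub> b \<gamma> v' c)
      \<in> tensor_rels K a V M xs ys"
    using assms \<gamma> unfolding tensor_rels_def Let_def in_verts by blast
  then show ?thesis
    by (rule cong_NI) (use assms \<gamma> in \<open>simp_all add: b_closed del: free_space_simps\<close>)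
qed

lemma b_smult_left:
  assumes "1 \<le> \<gamma>" "\<gamma> \<le> t" "d \<in> carrier K" "v \<in> carrier (space V (\<gamma> # ys))" "c \<in> carrier K"
  shows "b \<gamma> (d \<odot>\<^bsub>space V (\<gamma> # ys)\<^esub> v) c \<approx> d \<odot>\<^bsub>F\<^esub> b \<gamma> v c"
proof -
  have \<gamma>: "\<gamma> \<le> a" using assms t by simp
  interpret V\<gamma>: module K "space V (\<gamma> # ys)" by (rule module_V) fact+
  have "c \<in> carrier (space M (\<gamma> # xs))" using assms \<gamma> by (simp add: std_module_carrier)
  then have "b \<gamma> (d \<odot>\<^bsub>space V (\<gamma> # ys)\<^esub> v) c \<ominus>\<^bsub>F\<^esub> (d \<odot>\<^bsub>F\<^esub> b \<gamma> v c) \<in> tensor_rels K a V M xs ys"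
    using assms \<gamma> unfolding tensor_rels_def Let_def in_verts by blast
  then show ?thesis
    by (rule cong_NI) (use assms \<gamma> in \<open>simp_all add: b_closed del: free_space_simps\<close>)
qed

lemma b_smult_right:
  assumes "1 \<le> \<gamma>" "\<gamma> \<le> a" "d \<in> carrier K" "v \<in> carrier (space V (\<gamma> # ys))" "c \<in> carrier K"
    "t < \<gamma> \<longrightarrow> c = \<zero>\<^bsub>K\<^esub>"
  shows "b \<gamma> v (d \<otimes>\<^bsub>K\<^esub> c) \<approx> d \<odot>\<^bsub>F\<^esub> b \<gamma> v c"
proof -
  have "c \<in> carrier (space M (\<gamma> # xs))" using assms by (simp add: std_module_carrier)
  then have "b \<gamma> v (d \<odot>\<^bsub>space M (\<gamma> # xs)\<^esub> c) \<ominus>\<^bsub>F\<^esub> (d \<odot>\<^bsub>F\<^esub> b \<gamma> v c) \<in> tensor_rels K a V M xs ys"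
    using assms unfolding tensor_rels_def Let_def in_verts by blast
  then have "b \<gamma> v (d \<otimes>\<^bsub>K\<^esub> c) \<ominus>\<^bsub>F\<^esub> (d \<odot>\<^bsub>F\<^esub> b \<gamma> v c) \<in> tensor_rels K a V M xs ys"
    by (simp only: std_module_simps)
  then show ?thesis
    by (rule cong_NI) (use assms in \<open>auto simp add: b_closed simp del: free_space_simps\<close>)
qed

lemma b_balanced:
  assumes "1 \<le> \<gamma>" "Suc \<gamma> \<le> t" "v \<in> carrier (space V (\<gamma> # ys))" "c \<in> carrier K"
  shows "b (Suc \<gamma>) (act V (\<gamma> # ys) (Suc \<gamma> # ys) v) c \<approx> b \<gamma> v c"
proof -
  have \<gamma>: "Suc \<gamma> \<le> a" using assms t by simp
  have v': "act V (\<gamma> # ys) (Suc \<gamma> # ys) v \<in> carrier (space V (Suc \<gamma> # ys))"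
    using is_repD(5)[OF V arrows_A_quiver_Cons(1)[OF _ _ ys]] assms \<gamma> by simp
  have c: "c \<in> carrier (space M (Suc \<gamma> # xs))" using assms \<gamma> by (simp add: std_module_carrier)
  have act: "act M (Suc \<gamma> # xs) (\<gamma> # xs) c = c"
    using assms \<gamma> S[of \<gamma>] S[of "Suc \<gamma>"] by (simp add: std_module_def)
  have "(\<gamma>, Suc \<gamma>) \<in> arrows (linear_quiver a)" using assms \<gamma> by (simp add: linear_quiver_def)
  with assms c have "b (Suc \<gamma>) (act V (\<gamma> # ys) (Suc \<gamma> # ys) v) c
      \<ominus>\<^bsub>F\<^esub> b \<gamma> v (act M (Suc \<gamma> # xs) (\<gamma> # xs) c) \<in> tensor_rels K a V M xs ys"
    unfolding tensor_rels_def Let_def by blast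
  then have "b (Suc \<gamma>) (act V (\<gamma> # ys) (Suc \<gamma> # ys) v) c \<ominus>\<^bsub>F\<^esub> b \<gamma> v c \<in> tensor_rels K a V M xs ys"
    by (simp only: act)
  then show ?thesis
    by (rule cong_NI) (use assms \<gamma> v' in \<open>simp_all add: b_closed del: free_space_simps\<close>)
qed

text \<open>Balancing moves a generator up the linear quiver one step at a time, as long as \<open>M\<close> does not vanish.\<close>

lemma b_climb:
  assumes "1 \<le> \<gamma>" "\<gamma> \<le> l" "l \<le> t" "v \<in> carrier (space V (\<gamma> # ys))" "c \<in> carrier K"
  shows "b l (climb V ys \<gamma> l v) c \<approx> b \<gamma> v c"
  using assms(2,3)
proof (induction l rule: dec_induct)
  case base
  then show ?case using assms t by (simp add: N_refl b_closed)
next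
  case (step l)
  have "climb V ys \<gamma> l v \<in> carrier (space V (l # ys))"
    using climb_closed[OF V ys] step assms t by simp
  then have "b (Suc l) (act V (l # ys) (Suc l # ys) (climb V ys \<gamma> l v)) c \<approx> b l (climb V ys \<gamma> l v) c"
    using b_balanced[of l] step assms by simp
  then have "b (Suc l) (climb V ys \<gamma> (Suc l) v) c \<approx> b l (climb V ys \<gamma> l v) c"
    using step by simp
  then show ?case using N_trans step by simp
qed

abbreviation top_basis :: "'v \<Rightarrow> nat \<times> 'v \<times> 'k \<Rightarrow> 'k" where
  "top_basis w \<equiv> b t w \<one>\<^bsub>K\<^esub>"

lemma top_basis_closed: "w \<in> carrier W \<Longrightarrow> top_basis w \<in> carrier F"
  using b_closed t by simp

lemma top_basis_zero: "top_basis \<zero>\<^bsub>W\<^esub> \<approx> \<zero>\<^bsub>F\<^esub>"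
  using b_smult_left[of t "\<zero>\<^bsub>K\<^esub>" "\<zero>\<^bsub>W\<^esub>" "\<one>\<^bsub>K\<^esub>"] t top_basis_closed
  by (simp del: free_space_simps)

text \<open>Every generator is congruent to \<open>w \<otimes> 1\<close> in degree \<open>t\<close>, with \<open>w\<close> its value under the evaluation:
  pull out the scalar, climb to \<open>t\<close>, and absorb the scalar on the left. Generators above \<open>t\<close> have
  scalar zero and are congruent to zero.\<close>

lemma b_cong_top_basis:
  assumes "(\<gamma>, v, c) \<in> X"
  shows "b \<gamma> v c \<approx> top_basis (std_eval V ys t (\<gamma>, v, c))"
proof (cases "\<gamma> \<le> t")
  case True
  have x: "1 \<le> \<gamma>" "\<gamma> \<le> a" "v \<in> carrier (space V (\<gamma> # ys))" "c \<in> carrier K"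
    using assms by (auto simp: gens_iff)
  have w: "climb V ys \<gamma> t v \<in> carrier W" using climb_closed_t x True by blast
  have "b \<gamma> v (c \<otimes>\<^bsub>K\<^esub> \<one>\<^bsub>K\<^esub>) \<approx> c \<odot>\<^bsub>F\<^esub> b \<gamma> v \<one>\<^bsub>K\<^esub>"
    by (rule b_smult_right) (use x True in auto)
  moreover have "c \<odot>\<^bsub>F\<^esub> b \<gamma> v \<one>\<^bsub>K\<^esub> \<approx> c \<odot>\<^bsub>F\<^esub> top_basis (climb V ys \<gamma> t v)"
    by (rule N_smult[OF x(4) N_sym[OF b_climb]]) (use x True in auto)
  moreover have "c \<odot>\<^bsub>F\<^esub> top_basis (climb V ys \<gamma> t v) \<approx> top_basis (c \<odot>\<^bsub>W\<^esub> climb V ys \<gamma> t v)"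
    by (rule N_sym[OF b_smult_left]) (use x t w in auto)
  ultimately have "b \<gamma> v (c \<otimes>\<^bsub>K\<^esub> \<one>\<^bsub>K\<^esub>) \<approx> top_basis (c \<odot>\<^bsub>W\<^esub> climb V ys \<gamma> t v)"
    using N_trans by blast
  then show ?thesis using True x by (simp add: std_eval_def)
next
  case False
  have x: "1 \<le> \<gamma>" "\<gamma> \<le> a" "v \<in> carrier (space V (\<gamma> # ys))" "c = \<zero>\<^bsub>K\<^esub>"
    using assms False by (auto simp: gens_iff)
  have "b \<gamma> v (\<zero>\<^bsub>K\<^esub> \<otimes>\<^bsub>K\<^esub> \<zero>\<^bsub>K\<^esub>) \<approx> \<zero>\<^bsub>K\<^esub> \<odot>\<^bsub>F\<^esub> b \<gamma> v \<zero>\<^bsub>K\<^esub>"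
    by (rule b_smult_right) (use x in auto)
  then have "b \<gamma> v c \<approx> \<zero>\<^bsub>F\<^esub>" using x by (simp add: b_closed del: free_space_simps)
  then show ?thesis using N_trans N_sym[OF top_basis_zero] False by (simp add: std_eval_def)
qed

text \<open>Hence evaluation followed by \<open>w \<mapsto> w \<otimes> 1\<close> is the identity modulo the relations, and an element in
  the kernel of the evaluation lies in their span.\<close>

lemma cong_top_basis:
  assumes "f \<in> carrier F"
  shows "f \<approx> top_basis (q f)"
  using assms
proof (induction rule: K.free_space_induct)
  case zero
  then show ?case using N_sym[OF top_basis_zero] by (simp add: W.lin_ext_zero)
next
  case (upd f x c)
  obtain \<gamma> v d where x: "x = (\<gamma>, v, d)" by (cases x)
  let ?g = "std_eval V ys t x"
  have g: "?g \<in> carrier W" using funcset_mem[OF std_eval_funcset upd(2)] .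
  have qf: "q f \<in> carrier W" using q.f_im upd(1) by blast
  have "c \<odot>\<^bsub>F\<^esub> basis_vec K x \<approx> c \<odot>\<^bsub>F\<^esub> top_basis ?g"
    using N_smult[OF upd(4) b_cong_top_basis] upd(2) unfolding x by blast
  moreover have "c \<odot>\<^bsub>F\<^esub> top_basis ?g \<approx> top_basis (c \<odot>\<^bsub>W\<^esub> ?g)"
    by (rule N_sym[OF b_smult_left]) (use upd t g in auto)
  ultimately have "c \<odot>\<^bsub>F\<^esub> basis_vec K x \<approx> top_basis (c \<odot>\<^bsub>W\<^esub> ?g)" using N_trans by blast
  with upd.IH have "f \<oplus>\<^bsub>F\<^esub> c \<odot>\<^bsub>F\<^esub> basis_vec K x \<approx> top_basis (q f) \<oplus>\<^bsub>F\<^esub> top_basis (c \<odot>\<^bsub>W\<^esub> ?g)"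
    by (rule N_add)
  moreover have "top_basis (q f) \<oplus>\<^bsub>F\<^esub> top_basis (c \<odot>\<^bsub>W\<^esub> ?g) \<approx> top_basis (q f \<oplus>\<^bsub>W\<^esub> c \<odot>\<^bsub>W\<^esub> ?g)"
    by (rule N_sym[OF b_add_left]) (use upd(4) t g qf in auto)
  ultimately show ?case
    unfolding K.free_space_upd[OF upd(1,3,4)]
      W.lin_ext_upd[OF upd(1) std_eval_funcset upd(2-4), unfolded K.free_space_upd[OF upd(1,3,4)]]
    using N_trans by blast
qed

lemma N_eq_kernel: "N = {f \<in> carrier F. q f = \<zero>\<^bsub>W\<^esub>}"
proof
  show "{f \<in> carrier F. q f = \<zero>\<^bsub>W\<^esub>} \<subseteq> N"
  proof clarify
    fix f assume f: "f \<in> carrier F" "q f = \<zero>\<^bsub>W\<^esub>"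
    have "f \<approx> top_basis \<zero>\<^bsub>W\<^esub>" using cong_top_basis[OF f(1)] f(2) by simp
    then have "f \<approx> \<zero>\<^bsub>F\<^esub>" using top_basis_zero by (rule N_trans)
    then show "f \<in> N" by (rule F.cong_mod_zero[OF N_submodule])
  qed
qed (rule N_subset_kernel)

sublocale quotient_presentation K F W q N
proof
  show "q ` carrier F = carrier W"
  proof
    show "carrier W \<subseteq> q ` carrier F"
    proof
      fix w assume w: "w \<in> carrier W"
      have "q (top_basis w) = w" using q_b[of t w "\<one>\<^bsub>K\<^esub>"] w t by simp
      then show "w \<in> q ` carrier F" using top_basis_closed[OF w] by (metis imageI)
    qed
  qed auto
qed (rule q.f_hom N_eq_kernel)+

lemma fibre_lin_iso_tensor_space: "fibre F q \<in> lin_iso K W (tensor_space K a V M xs ys)"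
  unfolding tensor_space_def by (rule fibre_lin_iso)

end

text \<open>Under the identification of the tensor spaces with \<open>V(t)\<close> and \<open>V'(t')\<close>, the map induced by \<open>\<phi>\<close> becomes
  the linear map \<open>h\<close> that matches \<open>\<phi>\<close> on evaluations.\<close>

lemma tensor_map_fibre:
  assumes T: "std_tensor K a ms V S xs ys t" and T': "std_tensor K a ms' V' S' xs' ys' t'"
    and h: "h \<in> module_hom K (space V (t # ys)) (space V' (t' # ys'))"
    and \<phi>: "\<phi> \<in> tensor_gens a V (std_module K S) xs ys \<rightarrow> tensor_gens a V' (std_module K S') xs' ys'"
    and comm: "\<And>x. x \<in> tensor_gens a V (std_module K S) xs ys \<Longrightarrow>
      std_eval V' ys' t' (\<phi> x) = h (std_eval V ys t x)"
    and w: "w \<in> carrier (space V (t # ys))"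
  shows "tensor_map K a V' (std_module K S') xs' ys' \<phi>
      (fibre (free_space K (tensor_gens a V (std_module K S) xs ys))
        (lin_ext K (space V (t # ys)) (std_eval V ys t)) w) =
    fibre (free_space K (tensor_gens a V' (std_module K S') xs' ys'))
        (lin_ext K (space V' (t' # ys')) (std_eval V' ys' t')) (h w)"
proof -
  interpret A: std_tensor K a ms V S xs ys t by (rule T)
  interpret B: std_tensor K a ms' V' S' xs' ys' t' by (rule T')
  have "B.N +>\<^bsub>B.F\<^esub> push K \<phi> f = fibre B.F B.q (h w)" if "f \<in> fibre A.F A.q w" for f
  proof -
    have f: "f \<in> carrier A.F" "A.q f = w" using that by (auto simp: fibre_def)
    have "B.q (push K \<phi> f) = h (A.q f)"
      by (rule lin_ext_push[OF A.W.module_axioms B.W.module_axioms h A.std_eval_funcset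
            B.std_eval_funcset \<phi> comm f(1)])
    then show ?thesis using B.coset_eq_fibre[OF A.K.push_closed[OF f(1) \<phi>]] f(2) by simp
  qed
  moreover have "fibre A.F A.q w \<noteq> {}"
  proof -
    have "w \<in> A.q ` carrier A.F" using w by (simp only: A.surj)
    then obtain f where "f \<in> carrier A.F" "w = A.q f" by (elim imageE)
    then have "f \<in> fibre A.F A.q w" by (simp only: fibre_def mem_Collect_eq simp_thms)
    then show ?thesis by blast
  qed
  ultimately show ?thesis
    unfolding tensor_map_def by (intro SUP_eq_const)
qed

lemma module_hom_zero:
  assumes "f \<in> module_hom K M N" "module K M" "module K N"
  shows "f \<zero>\<^bsub>M\<^esub> = \<zero>\<^bsub>N\<^esub>"
proof -
  interpret mod_hom K M N f using assms by (simp add: mod_hom_def mod_hom_axioms_def)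
  show ?thesis by simp
qed

text \<open>A vertex of \<open>R \<times> Q\<close> is split into its first \<open>r\<close> coordinates, which \<open>\<theta>\<close> turns into a vertex of the linear
  quiver, and the remaining ones. The three constants are the data \<open>\<psi>\<close>, \<open>h\<close> and \<open>e\<close> of
  \<open>restricts_along\<close> for a tensor functor.\<close>

definition split_vertex :: "(nat list \<Rightarrow> nat) \<Rightarrow> nat \<Rightarrow> nat list \<Rightarrow> nat list" where
  "split_vertex \<theta> r z = \<theta> (take r z) # drop r z"

definition split_act ::
  "(nat list \<Rightarrow> nat) \<Rightarrow> nat \<Rightarrow> (nat list, 'k, 'v) rep \<Rightarrow> nat list \<Rightarrow> nat list \<Rightarrow> 'v \<Rightarrow> 'v" where
  "split_act \<theta> r V z z' =
     (if drop r z = drop r z' then climb V (drop r z) (\<theta> (take r z)) (\<theta> (take r z'))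
      else act V (split_vertex \<theta> r z) (split_vertex \<theta> r z'))"

definition split_iso ::
  "('k, 'z) ring_scheme \<Rightarrow> nat \<Rightarrow> nat list set \<Rightarrow> (nat list \<Rightarrow> nat) \<Rightarrow> nat \<Rightarrow>
   (nat list, 'k, 'v) rep \<Rightarrow> nat list \<Rightarrow> 'v \<Rightarrow> (nat \<times> 'v \<times> 'k \<Rightarrow> 'k) set" where
  "split_iso K a S \<theta> r V z =
     fibre (free_space K (tensor_gens a V (std_module K S) (take r z) (drop r z)))
       (lin_ext K (space V (split_vertex \<theta> r z)) (std_eval V (drop r z) (\<theta> (take r z))))"

text \<open>At every vertex \<open>xs\<close> the support of the standard module is the initial interval up to \<open>\<theta> xs\<close>, and these
  intervals grow along arrows. So the bimodule consists of indecomposable projective left modules and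
  inclusions between them, and tensoring with it is restriction along \<open>\<theta>\<close>.\<close>

locale initial_support =
  fixes K :: "('k, 'z) ring_scheme" and a :: nat and rs ms :: "nat list"
    and S :: "nat list set" and \<theta> :: "nat list \<Rightarrow> nat"
  assumes K: "field K"
    and \<theta>: "\<And>xs. xs \<in> verts (A_quiver rs) \<Longrightarrow> 1 \<le> \<theta> xs \<and> \<theta> xs \<le> a"
    and S: "\<And>xs \<gamma>. xs \<in> verts (A_quiver rs) \<Longrightarrow> 1 \<le> \<gamma> \<Longrightarrow> \<gamma> \<le> a \<Longrightarrow> \<gamma> # xs \<in> S \<longleftrightarrow> \<gamma> \<le> \<theta> xs"
    and mono: "\<And>xs xs'. (xs, xs') \<in> arrows (A_quiver rs) \<Longrightarrow> \<theta> xs \<le> \<theta> xs'"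
begin

abbreviation "r \<equiv> length rs"
abbreviation "Q \<equiv> A_quiver (a # ms)"
abbreviation "R \<equiv> A_quiver (rs @ ms)"
abbreviation "T \<equiv> tensor_functor K a rs ms (std_module K S)"

lemma vert: "z \<in> verts R \<Longrightarrow> split_vertex \<theta> r z \<in> verts Q"
  using \<theta>[of "take r z"] verts_A_quiver_append[of z rs ms]
  by (simp add: split_vertex_def verts_A_quiver_Cons)

lemma std_tensor:
  assumes "is_rep K Q V" "z \<in> verts R"
  shows "std_tensor K a ms V S (take r z) (drop r z) (\<theta> (take r z))"
  by (rule std_tensor.intro)
    (use K assms \<theta>[of "take r z"] S[of "take r z"] verts_A_quiver_append[of z rs ms] in auto)

lemma arrow_cases:
  assumes "(z, z') \<in> arrows R"
  obtains
    (left) "(take r z, take r z') \<in> arrows (A_quiver rs)" "take r z \<noteq> take r z'"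
      "drop r z' = drop r z" "drop r z \<in> verts (A_quiver ms)"
      "1 \<le> \<theta> (take r z)" "\<theta> (take r z) \<le> \<theta> (take r z')" "\<theta> (take r z') \<le> a"
  | (right) "take r z' = take r z" "drop r z \<noteq> drop r z'"
      "(drop r z, drop r z') \<in> arrows (A_quiver ms)"
      "drop r z \<in> verts (A_quiver ms)" "drop r z' \<in> verts (A_quiver ms)"
      "1 \<le> \<theta> (take r z)" "\<theta> (take r z) \<le> a"
      "sum_list (drop r z') = Suc (sum_list (drop r z))"
  using assms
proof (cases rule: arrows_A_quiver_append)
  case left
  then show thesis
    using that(1) sum_list_arrow[OF left(1)] mono[OF left(1)] \<theta> arrows_A_quiverD[OF left(1)]
    by fastforce
next
  case right
  then show thesis
    using that(2) sum_list_arrow[OF right(3)] \<theta>[OF right(2)] arrows_A_quiverD[OF right(3)]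
    by fastforce
qed

lemma split_act_hom:
  assumes V: "is_rep K Q V" and a: "(z, z') \<in> arrows R"
  shows "split_act \<theta> r V z z' \<in> module_hom K (space V (split_vertex \<theta> r z)) (space V (split_vertex \<theta> r z'))"
  using a
proof (cases rule: arrow_cases)
  case left
  then show ?thesis using climb_hom[OF V] by (simp add: split_act_def split_vertex_def)
next
  case right
  then show ?thesis
    using is_repD(4)[OF V arrows_A_quiver_Cons(2)] by (simp add: split_act_def split_vertex_def)
qed

text \<open>The composite along two arrows has a normal form that depends only on the two ends, apart from the
  case where both arrows lie in the last coordinates. The number of arrows of the latter kind is read
  off from the grading \<open>s\<close>, so two parallel paths fall into the same case. An arrow of each kind commutes
  with the other by \<open>climb_act\<close>.\<close>

lemma split_act_two_steps:
  assumes V: "is_rep K Q V" and xy: "(x, y) \<in> arrows R" and yz: "(y, z) \<in> arrows R"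
    and v: "v \<in> carrier (space V (split_vertex \<theta> r x))"
  defines "s \<equiv> \<lambda>z. sum_list (drop r z)" and "w \<equiv> split_act \<theta> r V y z (split_act \<theta> r V x y v)"
  shows "s z = s x \<and> w = climb V (drop r x) (\<theta> (take r x)) (\<theta> (take r z)) v
    \<or> s z = Suc (s x) \<and> w = act V (\<theta> (take r z) # drop r x) (\<theta> (take r z) # drop r z)
        (climb V (drop r x) (\<theta> (take r x)) (\<theta> (take r z)) v)
    \<or> s z = Suc (Suc (s x)) \<and> 1 \<le> \<theta> (take r x) \<and> \<theta> (take r x) \<le> a \<and>
      (drop r x, drop r y) \<in> arrows (A_quiver ms) \<and> (drop r y, drop r z) \<in> arrows (A_quiver ms) \<and>
      w = act V (\<theta> (take r x) # drop r y) (\<theta> (take r x) # drop r z)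
        (act V (\<theta> (take r x) # drop r x) (\<theta> (take r x) # drop r y) v)"
  using xy
proof (cases rule: arrow_cases)
  case xy: left
  from yz show ?thesis
  proof (cases rule: arrow_cases)
    case left
    then show ?thesis using xy climb_trans[of "\<theta> (take r x)" "\<theta> (take r y)" "\<theta> (take r z)"]
      by (simp add: s_def w_def split_act_def split_vertex_def)
  next
    case right
    then show ?thesis using xy by (simp add: s_def w_def split_act_def split_vertex_def)
  qed
next
  case xy: right
  from yz show ?thesis
  proof (cases rule: arrow_cases)
    case left
    then show ?thesis
      using xy v climb_act[OF V xy(3), of "\<theta> (take r x)" "\<theta> (take r z)" v]
      by (simp add: s_def w_def split_act_def split_vertex_def)
  next
    case right
    then show ?thesis using xy by (simp add: s_def w_def split_act_def split_vertex_def)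
  qed
qed

lemma split_act_commute:
  assumes V: "is_rep K Q V" and a: "(x, y) \<in> arrows R" "(y, z) \<in> arrows R"
    "(x, y') \<in> arrows R" "(y', z) \<in> arrows R"
    and v: "v \<in> carrier (space V (split_vertex \<theta> r x))"
  shows "split_act \<theta> r V y z (split_act \<theta> r V x y v) = split_act \<theta> r V y' z (split_act \<theta> r V x y' v)"
proof -
  have "act V (k # drop r y) (k # drop r z) (act V (k # drop r x) (k # drop r y) v) =
      act V (k # drop r y') (k # drop r z) (act V (k # drop r x) (k # drop r y') v)"
    if "1 \<le> k" "k \<le> a" "(drop r x, drop r y) \<in> arrows (A_quiver ms)" "(drop r y, drop r z) \<in> arrows (A_quiver ms)"
      "(drop r x, drop r y') \<in> arrows (A_quiver ms)" "(drop r y', drop r z) \<in> arrows (A_quiver ms)"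
      "k = \<theta> (take r x)" for k
    by (rule is_repD(6)[OF V]) (use that v in \<open>auto intro!: arrows_A_quiver_Cons(2) simp: split_vertex_def\<close>)
  then show ?thesis
    using split_act_two_steps[OF V a(1,2) v] split_act_two_steps[OF V a(3,4) v] by auto
qed

lemma split_act_natural:
  assumes V: "is_rep K Q V" and f: "f \<in> rep_hom K Q V W" and a: "(z, z') \<in> arrows R"
    and v: "v \<in> carrier (space V (split_vertex \<theta> r z))"
  shows "f (split_vertex \<theta> r z') (split_act \<theta> r V z z' v) = split_act \<theta> r W z z' (f (split_vertex \<theta> r z) v)"
  using a
proof (cases rule: arrow_cases)
  case left
  then show ?thesis using climb_rep_hom[OF V f] v by (simp add: split_act_def split_vertex_def)
next
  case right
  then show ?thesis
    using rep_hom_act[OF f arrows_A_quiver_Cons(2)] v by (simp add: split_act_def split_vertex_def)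
qed

lemma tensor_act_split_iso:
  assumes V: "is_rep K Q V" and a: "(z, z') \<in> arrows R"
    and v: "v \<in> carrier (space V (split_vertex \<theta> r z))"
  shows "act (FObj T V) z z' (split_iso K a S \<theta> r V z v) =
    split_iso K a S \<theta> r V z' (split_act \<theta> r V z z' v)"
proof -
  let ?M = "std_module K S"
  define \<phi> where "\<phi> = (\<lambda>(\<gamma>, v, m). (\<gamma>,
      if drop r z = drop r z' then v else act V (\<gamma> # drop r z) (\<gamma> # drop r z') v,
      if take r z = take r z' then m else act ?M (\<gamma> # take r z) (\<gamma> # take r z') m))"
  interpret A: std_tensor K a ms V S "take r z" "drop r z" "\<theta> (take r z)"
    by (rule std_tensor[OF V arrows_A_quiverD(1)[OF a]])
  interpret B: std_tensor K a ms V S "take r z'" "drop r z'" "\<theta> (take r z')"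
    by (rule std_tensor[OF V arrows_A_quiverD(2)[OF a]])
  have *: "\<phi> x \<in> B.X \<and>
      std_eval V (drop r z') (\<theta> (take r z')) (\<phi> x) =
      split_act \<theta> r V z z' (std_eval V (drop r z) (\<theta> (take r z)) x)" if x: "x \<in> A.X" for x
  proof -
    obtain \<gamma> u c where x': "x = (\<gamma>, u, c)" by (cases x)
    have g: "1 \<le> \<gamma>" "\<gamma> \<le> a" "u \<in> carrier (space V (\<gamma> # drop r z))" "c \<in> carrier K"
      "\<theta> (take r z) < \<gamma> \<Longrightarrow> c = \<zero>\<^bsub>K\<^esub>"
      using x unfolding x' A.gens_iff by auto
    note hom0 = module_hom_zero[OF split_act_hom[OF V a], unfolded split_vertex_def,
        OF A.W.module_axioms B.W.module_axioms]
    note hom_smult = module_hom_smult[OF split_act_hom[OF V a], unfolded split_vertex_def]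
    from a show ?thesis
    proof (cases rule: arrow_cases)
      case left
      \<comment> \<open>Below the support bound both degrees lie in the support; above it the scalar is zero.\<close>
      have "act ?M (\<gamma> # take r z) (\<gamma> # take r z') c = c"
        using A.S[OF g(1,2)] B.S[OF g(1,2)] g left by (auto simp: std_module_def)
      then have \<phi>x: "\<phi> x = (\<gamma>, u, c)" using left by (simp add: \<phi>_def x')
      have "std_eval V (drop r z') (\<theta> (take r z')) (\<gamma>, u, c) =
        split_act \<theta> r V z z' (std_eval V (drop r z) (\<theta> (take r z)) (\<gamma>, u, c))"
      proof (cases "\<gamma> \<le> \<theta> (take r z)")
        case True
        then have u: "climb V (drop r z) \<gamma> (\<theta> (take r z)) u \<in> carrier A.W"
          using A.climb_closed_t g by blast
        have "split_act \<theta> r V z z' (climb V (drop r z) \<gamma> (\<theta> (take r z)) u) =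
            climb V (drop r z') \<gamma> (\<theta> (take r z')) u"
          using left True climb_trans[of \<gamma> "\<theta> (take r z)" "\<theta> (take r z')"]
          by (simp add: split_act_def)
        then show ?thesis using True left(6) hom_smult[OF g(4) u] by (simp add: std_eval_def)
      next
        case False
        then show ?thesis
          using g B.W.smult_l_null[OF B.climb_closed_t[of \<gamma> u]] left(3) hom0 by (simp add: std_eval_def)
      qed
      moreover have "(\<gamma>, u, c) \<in> B.X"
        unfolding B.gens_iff using left(3,6) g by (auto dest: le_less_trans)
      ultimately show ?thesis using \<phi>x unfolding x' by simp
    next
      case right
      have \<phi>x: "\<phi> x = (\<gamma>, act V (\<gamma> # drop r z) (\<gamma> # drop r z') u, c)" using right by (simp add: \<phi>_def x')
      have "act V (\<gamma> # drop r z) (\<gamma> # drop r z') u \<in> carrier (space V (\<gamma> # drop r z'))"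
        using is_repD(5)[OF V arrows_A_quiver_Cons(2)[OF g(1,2) right(3)] g(3)] .
      then have "\<phi> x \<in> B.X" using right g unfolding \<phi>x B.gens_iff by auto
      moreover have "std_eval V (drop r z') (\<theta> (take r z')) (\<phi> x) =
        split_act \<theta> r V z z' (std_eval V (drop r z) (\<theta> (take r z)) (\<gamma>, u, c))"
      proof (cases "\<gamma> \<le> \<theta> (take r z)")
        case True
        then have u: "climb V (drop r z) \<gamma> (\<theta> (take r z)) u \<in> carrier A.W"
          using A.climb_closed_t g by blast
        have "split_act \<theta> r V z z' (climb V (drop r z) \<gamma> (\<theta> (take r z)) u) =
            climb V (drop r z') \<gamma> (\<theta> (take r z')) (act V (\<gamma> # drop r z) (\<gamma> # drop r z') u)"
          using right True climb_act[OF V right(3) True g(1) right(7) g(3)]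
          by (simp add: split_act_def split_vertex_def)
        then show ?thesis
          unfolding \<phi>x using True right(1) hom_smult[OF g(4) u] by (simp add: std_eval_def)
      next
        case False
        then show ?thesis unfolding \<phi>x using hom0 right(1) by (simp add: std_eval_def)
      qed
      ultimately show ?thesis unfolding x' by simp
    qed
  qed
  have "tensor_map K a V ?M (take r z') (drop r z') \<phi> (fibre A.F A.q v) =
      fibre B.F B.q (split_act \<theta> r V z z' v)"
    by (rule tensor_map_fibre[OF A.std_tensor_axioms B.std_tensor_axioms])
      (use * split_act_hom[OF V a] v in \<open>auto simp: split_vertex_def\<close>)
  then show ?thesis
    by (simp add: tensor_functor_def Let_def tensor_rep_def \<phi>_def split_iso_def split_vertex_def)
qed

lemma tensor_map_split_iso:
  assumes V: "is_rep K Q V" and W: "is_rep K Q W" and f: "f \<in> rep_hom K Q V W" and z: "z \<in> verts R"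
    and v: "v \<in> carrier (space V (split_vertex \<theta> r z))"
  shows "FMap T V W f z (split_iso K a S \<theta> r V z v) =
    split_iso K a S \<theta> r W z (f (split_vertex \<theta> r z) v)"
proof -
  let ?M = "std_module K S"
  define \<phi> where "\<phi> = (\<lambda>(\<gamma>::nat, v, m::'k). (\<gamma>, f (\<gamma> # drop r z) v, m))"
  interpret A: std_tensor K a ms V S "take r z" "drop r z" "\<theta> (take r z)"
    by (rule std_tensor[OF V z])
  interpret B: std_tensor K a ms W S "take r z" "drop r z" "\<theta> (take r z)"
    by (rule std_tensor[OF W z])
  have f_hom: "f (\<theta> (take r z) # drop r z) \<in> module_hom K A.W B.W"
    using rep_homD(1)[OF f vert[OF z]] by (simp add: split_vertex_def)
  have *: "\<phi> x \<in> B.X \<and>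
      std_eval W (drop r z) (\<theta> (take r z)) (\<phi> x) =
      f (\<theta> (take r z) # drop r z) (std_eval V (drop r z) (\<theta> (take r z)) x)" if x: "x \<in> A.X" for x
  proof -
    obtain \<gamma> u c where x': "x = (\<gamma>, u, c)" by (cases x)
    have g: "1 \<le> \<gamma>" "\<gamma> \<le> a" "u \<in> carrier (space V (\<gamma> # drop r z))" "c \<in> carrier K"
      "\<theta> (take r z) < \<gamma> \<Longrightarrow> c = \<zero>\<^bsub>K\<^esub>"
      using x unfolding x' A.gens_iff by auto
    have "f (\<gamma> # drop r z) u \<in> carrier (space W (\<gamma> # drop r z))"
      using rep_homD(3)[OF f A.vert[OF g(1,2)] g(3)] .
    moreover have "f (\<theta> (take r z) # drop r z) (climb V (drop r z) \<gamma> (\<theta> (take r z)) u) =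
        climb W (drop r z) \<gamma> (\<theta> (take r z)) (f (\<gamma> # drop r z) u)" if "\<gamma> \<le> \<theta> (take r z)"
      using climb_rep_hom[OF V f A.ys that g(1) A.t(2) g(3)] .
    ultimately show ?thesis
      using g module_hom_zero[OF f_hom A.W.module_axioms B.W.module_axioms]
        module_hom_smult[OF f_hom g(4)] A.climb_closed_t[OF g(1) _ g(3)]
      by (auto simp: x' \<phi>_def B.gens_iff std_eval_def)
  qed
  have "tensor_map K a W ?M (take r z) (drop r z) \<phi> (fibre A.F A.q v) =
      fibre B.F B.q (f (\<theta> (take r z) # drop r z) v)"
    by (rule tensor_map_fibre[OF A.std_tensor_axioms B.std_tensor_axioms f_hom])
      (use * v in \<open>auto simp: split_vertex_def\<close>)
  moreover have "fibre A.F A.q v \<in> carrier (tensor_space K a V ?M (take r z) (drop r z))"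
    using lin_isoD(6)[OF A.fibre_lin_iso_tensor_space] v by (simp add: split_vertex_def)
  ultimately show ?thesis
    using z by (simp add: tensor_functor_def Let_def \<phi>_def split_iso_def split_vertex_def)
qed

lemma restricts_along_tensor_functor:
  "restricts_along K Q R T (split_vertex \<theta> r) (split_act \<theta> r) (split_iso K a S \<theta> r)"
proof (rule restricts_alongI[OF well_formed_A_quiver well_formed_A_quiver])
  fix V z assume V: "is_rep K Q V" and z: "z \<in> verts R"
  interpret A: std_tensor K a ms V S "take r z" "drop r z" "\<theta> (take r z)"
    by (rule std_tensor[OF V z])
  show "split_iso K a S \<theta> r V z \<in> lin_iso K (space V (split_vertex \<theta> r z)) (space (FObj T V) z)"
    using A.fibre_lin_iso_tensor_space
    by (simp add: tensor_functor_def Let_def tensor_rep_def split_iso_def split_vertex_def)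
next
  show "act (FObj T V) z z' (split_iso K a S \<theta> r V z v) =
      split_iso K a S \<theta> r V z' (split_act \<theta> r V z z' v)"
    if "is_rep K Q V" "(z, z') \<in> arrows R" "v \<in> carrier (space V (split_vertex \<theta> r z))" for V z z' v
    by (rule tensor_act_split_iso[OF that])
  show "FMap T V W f z (split_iso K a S \<theta> r V z v) =
      split_iso K a S \<theta> r W z (f (split_vertex \<theta> r z) v)"
    if "is_rep K Q V" "is_rep K Q W" "f \<in> rep_hom K Q V W" "z \<in> verts R"
      "v \<in> carrier (space V (split_vertex \<theta> r z))" for V W f z v
    by (rule tensor_map_split_iso[OF that])
qed (auto intro: vert split_act_hom split_act_commute split_act_natural
      simp: tensor_functor_def Let_def tensor_rep_def)

end


section \<open>Functors on representations of a linear quiver\<close>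

text \<open>For a source \<open>\<A>\<^sub>a\<close> the maps \<open>\<psi>\<close> and \<open>h\<close> are determined by a map \<open>\<theta>\<close> of vertices: between two vertices of a
  linear quiver there is at most one path, so \<open>h\<close> is transport along it, provided \<open>\<theta>\<close> is monotone.
  The conditions are imposed on vertices and arrows only, where \<open>\<theta>\<close> is meaningful.\<close>

definition pulls_back ::
  "('k, 'z) ring_scheme \<Rightarrow> nat \<Rightarrow> nat list quiver \<Rightarrow>
   ((nat list, 'k, 'v) rep, nat list \<Rightarrow> 'v \<Rightarrow> 'v, (nat list, 'k, 'w) rep, nat list \<Rightarrow> 'w \<Rightarrow> 'w) cat_functor \<Rightarrow>
   (nat list \<Rightarrow> nat) \<Rightarrow> bool" where
  "pulls_back K a R F \<theta> \<longleftrightarrow>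
     (\<exists>\<psi> h e. restricts_along K (A_quiver [a]) R F \<psi> h e \<and>
        (\<forall>z\<in>verts R. \<psi> z = [\<theta> z]) \<and>
        (\<forall>(z, z')\<in>arrows R. \<theta> z \<le> \<theta> z' \<and> (\<forall>V. h V z z' = climb V [] (\<theta> z) (\<theta> z'))))"

lemma pulls_back_tensor_functor:
  assumes "initial_support K a rs S \<theta>"
  shows "pulls_back K a (A_quiver rs) (tensor_functor K a rs [] (std_module K S)) \<theta>"
proof -
  interpret initial_support K a rs "[]" S \<theta> by (rule assms)
  have z: "take r z = z" "drop r z = []" if "z \<in> verts (A_quiver rs)" for z
    using that by (simp_all add: verts_A_quiver)
  have "restricts_along K (A_quiver [a]) (A_quiver rs) T
      (split_vertex \<theta> r) (split_act \<theta> r) (split_iso K a S \<theta> r)"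
    using restricts_along_tensor_functor by simp
  moreover have "\<forall>z\<in>verts (A_quiver rs). split_vertex \<theta> r z = [\<theta> z]"
    by (simp add: split_vertex_def z)
  moreover have "\<theta> z \<le> \<theta> z' \<and> (\<forall>V. split_act \<theta> r V z z' = climb V [] (\<theta> z) (\<theta> z'))"
    if "(z, z') \<in> arrows (A_quiver rs)" for z z'
    using mono[OF that] arrows_A_quiverD[OF that] by (simp add: split_act_def z)
  ultimately show ?thesis unfolding pulls_back_def by blast
qed

text \<open>A path in the first coordinate of the target is realised in \<open>V\<close> by the path between the images of its
  ends, because climbing is transitive and \<open>\<theta>\<close> is monotone.\<close>

lemma climb_image:
  assumes F: "restricts_along K (A_quiver [a]) (A_quiver (b # ms)) F \<psi> h e"
    and \<psi>: "\<And>z. z \<in> verts (A_quiver (b # ms)) \<Longrightarrow> \<psi> z = [\<theta> z]"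
    and h: "\<And>z z' V. (z, z') \<in> arrows (A_quiver (b # ms)) \<Longrightarrow>
      \<theta> z \<le> \<theta> z' \<and> h V z z' = climb V [] (\<theta> z) (\<theta> z')"
    and V: "is_rep K (A_quiver [a]) V" and ys: "ys \<in> verts (A_quiver ms)"
    and "k \<le> l" "1 \<le> k" "l \<le> b" and v: "v \<in> carrier (space V [\<theta> (k # ys)])"
  shows "\<theta> (k # ys) \<le> \<theta> (l # ys) \<and>
    climb V [] (\<theta> (k # ys)) (\<theta> (l # ys)) v \<in> carrier (space V [\<theta> (l # ys)]) \<and>
    climb (FObj F V) ys k l (e V (k # ys) v) =
      e V (l # ys) (climb V [] (\<theta> (k # ys)) (\<theta> (l # ys)) v)"
  using assms(6-8)
proof (induction l rule: dec_induct)
  case (step l)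
  have a: "(l # ys, Suc l # ys) \<in> arrows (A_quiver (b # ms))"
    using arrows_A_quiver_Cons(1)[OF _ _ ys, of l b] step by simp
  note vl = \<psi>[OF arrows_A_quiverD(1)[OF a]] \<psi>[OF arrows_A_quiverD(2)[OF a]]
  let ?u = "climb V [] (\<theta> (k # ys)) (\<theta> (l # ys)) v"
  have IH: "\<theta> (k # ys) \<le> \<theta> (l # ys)" "?u \<in> carrier (space V [\<theta> (l # ys)])"
    "climb (FObj F V) ys k l (e V (k # ys) v) = e V (l # ys) ?u" using step by auto
  have "?u \<in> carrier (space V (\<psi> (l # ys)))" using IH vl by simp
  note * = restricts_alongD(6,7)[OF F V a this]
  have le: "\<theta> (l # ys) \<le> \<theta> (Suc l # ys)"
    and hV: "h V (l # ys) (Suc l # ys) = climb V [] (\<theta> (l # ys)) (\<theta> (Suc l # ys))"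
    using h[OF a] by blast+
  have trans: "climb V [] (\<theta> (l # ys)) (\<theta> (Suc l # ys)) ?u =
      climb V [] (\<theta> (k # ys)) (\<theta> (Suc l # ys)) v"
    by (rule climb_trans[OF IH(1) le])
  show ?case using *[unfolded hV trans vl] IH(1,3) le step(1) by simp
qed (use v in simp)

text \<open>Both kinds of arrows of the new target are sent to paths of \<open>\<A>\<^sub>a\<close>: one in the last coordinates is an
  arrow of the old target, one in the first coordinates becomes a path in its first coordinate, to
  which \<open>climb_image\<close> applies.\<close>

lemma pulls_back_tensor_functor_comp:
  assumes F: "pulls_back K a (A_quiver (b # ms)) F \<theta>" and S: "initial_support K b rs S \<theta>'"
  shows "pulls_back K a (A_quiver (rs @ ms)) (tensor_functor K b rs ms (std_module K S) \<circ>\<^sub>F F)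
    (\<lambda>z. \<theta> (split_vertex \<theta>' (length rs) z))"
proof -
  interpret initial_support K b rs ms S \<theta>' by (rule S)
  obtain \<psi> h e where F: "restricts_along K (A_quiver [a]) Q F \<psi> h e"
    and \<psi>: "\<And>z. z \<in> verts Q \<Longrightarrow> \<psi> z = [\<theta> z]"
    and h: "\<And>z z' V. (z, z') \<in> arrows Q \<Longrightarrow> \<theta> z \<le> \<theta> z' \<and> h V z z' = climb V [] (\<theta> z) (\<theta> z')"
    using F unfolding pulls_back_def by blast
  let ?\<theta> = "\<lambda>z. \<theta> (split_vertex \<theta>' r z)"
  have step: "?\<theta> z \<le> ?\<theta> z' \<and> climb V [] (?\<theta> z) (?\<theta> z') v \<in> carrier (space V (\<psi> (split_vertex \<theta>' r z'))) \<and>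
      split_act \<theta>' r (FObj F V) z z' (e V (split_vertex \<theta>' r z) v) =
        e V (split_vertex \<theta>' r z') (climb V [] (?\<theta> z) (?\<theta> z') v)"
    if V: "is_rep K (A_quiver [a]) V" and a: "(z, z') \<in> arrows R"
      and v: "v \<in> carrier (space V (\<psi> (split_vertex \<theta>' r z)))" for V z z' v
  proof -
    note \<psi>z = \<psi>[OF vert[OF arrows_A_quiverD(1)[OF a]]] \<psi>[OF vert[OF arrows_A_quiverD(2)[OF a]]]
    from a show ?thesis
    proof (cases rule: arrow_cases)
      case left
      then show ?thesis
        using climb_image[OF F \<psi> h V left(4,6,5,7)] v \<psi>z by (simp add: split_act_def split_vertex_def)
    next
      case right
      have q: "(split_vertex \<theta>' r z, split_vertex \<theta>' r z') \<in> arrows Q"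
        using arrows_A_quiver_Cons(2)[OF right(6,7,3)] right(1) by (simp add: split_vertex_def)
      show ?thesis
        using restricts_alongD(6,7)[OF F V q v] h[OF q] right(2) by (simp add: split_act_def)
    qed
  qed
  have mono: "?\<theta> z \<le> ?\<theta> z'" if a: "(z, z') \<in> arrows R" for z z'
    using a
  proof (cases rule: arrow_cases)
    case left
    have "\<theta> (k # drop r z) \<le> \<theta> (l # drop r z)" if "k \<le> l" "1 \<le> k" "l \<le> b" for k l
      using that
    proof (induction l rule: dec_induct)
      case (step l)
      then show ?case
        using h[OF arrows_A_quiver_Cons(1)[OF _ _ left(4)], of l] by fastforce
    qed simp
    then show ?thesis using left by (simp add: split_vertex_def)
  next
    case right
    then show ?thesis
      using h[OF arrows_A_quiver_Cons(2)[OF right(6,7,3)]] by (simp add: split_vertex_def)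
  qed
  have "restricts_along K (A_quiver [a]) R (T \<circ>\<^sub>F F) (\<lambda>z. \<psi> (split_vertex \<theta>' r z))
      (\<lambda>V z z'. climb V [] (?\<theta> z) (?\<theta> z'))
      (\<lambda>V z v. split_iso K b S \<theta>' r (FObj F V) z (e V (split_vertex \<theta>' r z) v))"
    by (rule restricts_along_comp[OF F restricts_along_tensor_functor well_formed_A_quiver])
      (use step in blast)
  then show ?thesis
    unfolding pulls_back_def using \<psi>[OF vert] mono by blast
qed

lemma swap_arrow:
  assumes "(z, z') \<in> arrows (A_quiver [m, n, p])"
  shows "(swap_last_two z, swap_last_two z') \<in> arrows (A_quiver [m, p, n])"
proof -
  obtain x y w where z: "z = [x, y, w]" "1 \<le> x" "x \<le> m" "1 \<le> y" "y \<le> n" "1 \<le> w" "w \<le> p"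
    using arrows_A_quiverD(1)[OF assms]
    by (auto simp: verts_A_quiver length_Suc_conv less_Suc_eq numeral_3_eq_3 all_conj_distrib)
  have zs: "swap_last_two z = [x, w, y]" by (simp add: z(1) swap_last_two_def)
  obtain l where l: "l < 3" "z' = z[l := Suc (z ! l)]" "Suc (z ! l) \<le> [m, n, p] ! l"
    using assms that by (auto simp: arrows_A_quiver numeral_3_eq_3)
  have v: "[x, w, y] \<in> verts (A_quiver [m, p, n])"
    using z by (auto simp: verts_A_quiver less_Suc_eq numeral_3_eq_3)
  consider "l = 0" | "l = 1" | "l = 2" using l(1) by linarith
  then show ?thesis
  proof cases
    case 1
    then show ?thesis using l z(1) v unfolding zs arrows_A_quiver
      by (intro conjI exI[of _ 0]) (auto simp: swap_last_two_def)
  next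
    case 2
    then show ?thesis using l z(1) v unfolding zs arrows_A_quiver
      by (intro conjI exI[of _ 2]) (auto simp: swap_last_two_def numeral_2_eq_2)
  next
    case 3
    then show ?thesis using l z(1) v unfolding zs arrows_A_quiver
      by (intro conjI exI[of _ 1]) (auto simp: swap_last_two_def numeral_2_eq_2)
  qed
qed

lemma swap_vert:
  "z \<in> verts (A_quiver [m, n, p]) \<Longrightarrow> swap_last_two z \<in> verts (A_quiver [m, p, n])"
  by (auto simp: verts_A_quiver swap_last_two_def less_Suc_eq numeral_3_eq_3 numeral_2_eq_2
        all_conj_distrib)

lemma restricts_along_flip_functor:
  "restricts_along K (A_quiver [m, p, n]) (A_quiver [m, n, p]) (flip_functor m p n) swap_last_two
     (\<lambda>V z z'. act V (swap_last_two z) (swap_last_two z')) (\<lambda>V z v. v)"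
proof (rule restricts_alongI[OF well_formed_A_quiver well_formed_A_quiver])
  fix V z assume V: "is_rep K (A_quiver [m, p, n]) V" and z: "z \<in> verts (A_quiver [m, n, p])"
  interpret module K "space V (swap_last_two z)" by (rule is_repD(2)[OF V swap_vert[OF z]])
  show "(\<lambda>v. v) \<in> lin_iso K (space V (swap_last_two z)) (space (FObj (flip_functor m p n) V) z)"
    by (auto simp: lin_iso_def module_hom_def flip_functor_def bij_betw_def)
next
  fix V x y y' z v
  assume "is_rep K (A_quiver [m, p, n]) V" "(x, y) \<in> arrows (A_quiver [m, n, p])"
    "(y, z) \<in> arrows (A_quiver [m, n, p])" "(x, y') \<in> arrows (A_quiver [m, n, p])"
    "(y', z) \<in> arrows (A_quiver [m, n, p])" "v \<in> carrier (space V (swap_last_two x))"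
  then show "act V (swap_last_two y) (swap_last_two z) (act V (swap_last_two x) (swap_last_two y) v) =
      act V (swap_last_two y') (swap_last_two z) (act V (swap_last_two x) (swap_last_two y') v)"
    by (intro is_repD(6)) (auto intro: swap_arrow)
qed (auto intro: swap_vert is_repD(4) swap_arrow rep_hom_act rep_homD(2) simp: flip_functor_def)

lemma pulls_back_flip_functor_comp:
  assumes F: "pulls_back K a (A_quiver [m, p, n]) F \<theta>"
  shows "pulls_back K a (A_quiver [m, n, p]) (flip_functor m p n \<circ>\<^sub>F F) (\<lambda>z. \<theta> (swap_last_two z))"
proof -
  obtain \<psi> h e where F: "restricts_along K (A_quiver [a]) (A_quiver [m, p, n]) F \<psi> h e"
    and \<psi>: "\<And>z. z \<in> verts (A_quiver [m, p, n]) \<Longrightarrow> \<psi> z = [\<theta> z]"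
    and h: "\<And>z z' V. (z, z') \<in> arrows (A_quiver [m, p, n]) \<Longrightarrow>
      \<theta> z \<le> \<theta> z' \<and> h V z z' = climb V [] (\<theta> z) (\<theta> z')"
    using F unfolding pulls_back_def by blast
  have "restricts_along K (A_quiver [a]) (A_quiver [m, n, p]) (flip_functor m p n \<circ>\<^sub>F F)
      (\<lambda>z. \<psi> (swap_last_two z)) (\<lambda>V z z'. h V (swap_last_two z) (swap_last_two z'))
      (\<lambda>V z v. e V (swap_last_two z) v)"
    by (rule restricts_along_comp[OF F restricts_along_flip_functor well_formed_A_quiver])
      (use restricts_alongD(6,7)[OF F] swap_arrow in blast)
  then show ?thesis
    unfolding pulls_back_def using \<psi>[OF swap_vert] h[OF swap_arrow] by blast
qed

lemma naturally_isomorphic_if_pull_back_alike: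
  assumes F: "pulls_back K a (A_quiver ms) F \<theta>" and G: "pulls_back K a (A_quiver ms) G \<theta>'"
    and eq: "\<And>z. z \<in> verts (A_quiver ms) \<Longrightarrow> \<theta> z = \<theta>' z"
  shows "naturally_isomorphic (rep_cat K (A_quiver [a])) (rep_cat K (A_quiver ms)) F G"
proof -
  obtain \<psi> h e where F: "restricts_along K (A_quiver [a]) (A_quiver ms) F \<psi> h e"
    and \<psi>: "\<And>z. z \<in> verts (A_quiver ms) \<Longrightarrow> \<psi> z = [\<theta> z]"
    and h: "\<And>z z' V. (z, z') \<in> arrows (A_quiver ms) \<Longrightarrow> h V z z' = climb V [] (\<theta> z) (\<theta> z')"
    using F unfolding pulls_back_def by blast
  obtain \<psi>' h' e' where G: "restricts_along K (A_quiver [a]) (A_quiver ms) G \<psi>' h' e'"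
    and \<psi>': "\<And>z. z \<in> verts (A_quiver ms) \<Longrightarrow> \<psi>' z = [\<theta>' z]"
    and h': "\<And>z z' V. (z, z') \<in> arrows (A_quiver ms) \<Longrightarrow> h' V z z' = climb V [] (\<theta>' z) (\<theta>' z')"
    using G unfolding pulls_back_def by blast
  show ?thesis
    by (rule naturally_isomorphic_if_restrict_alike[OF F G well_formed_A_quiver])
      (simp_all add: \<psi> \<psi>' h h' eq arrows_A_quiverD)
qed


section \<open>The functors \<open>\<nabla>\<close>\<close>

text \<open>The largest \<open>\<gamma>\<close> with \<open>(\<gamma>, \<mu>, \<nu>)\<close> in the support of \<open>M\<^sub>m\<^sub>;\<^sub>i\<^sup>n\<close>. This is the monotone map that replaces the
  vertex \<open>i\<close> of \<open>{1..m}\<close> by a chain of \<open>n\<close> vertices.\<close>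

definition nabla_vertex :: "nat \<Rightarrow> nat \<Rightarrow> nat list \<Rightarrow> nat" where
  "nabla_vertex i n xs =
     (let \<mu> = xs ! 0; \<nu> = xs ! 1 in if \<mu> < i then \<mu> else if \<mu> = i then i + \<nu> - 1 else \<mu> + n - 1)"

lemma initial_support_nabla:
  assumes "field K" "1 \<le> i" "i \<le> m"
  shows "initial_support K (m + n - 1) [m, n] (nabla_support m i n) (nabla_vertex i n)"
proof (rule initial_support.intro)
  fix xs assume "xs \<in> verts (A_quiver [m, n])"
  then obtain \<mu> \<nu> where xs: "xs = [\<mu>, \<nu>]" "1 \<le> \<mu>" "\<mu> \<le> m" "1 \<le> \<nu>" "\<nu> \<le> n"
    by (auto simp: verts_A_quiver length_Suc_conv less_Suc_eq numeral_2_eq_2 all_conj_distrib)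
  then show "1 \<le> nabla_vertex i n xs \<and> nabla_vertex i n xs \<le> m + n - 1"
    using assms by (auto simp: nabla_vertex_def)
  fix \<gamma> assume "1 \<le> \<gamma>" "\<gamma> \<le> m + n - 1"
  then show "\<gamma> # xs \<in> nabla_support m i n \<longleftrightarrow> \<gamma> \<le> nabla_vertex i n xs"
    using xs assms by (auto simp: nabla_vertex_def nabla_support_def)
next
  fix xs xs' assume a: "(xs, xs') \<in> arrows (A_quiver [m, n])"
  then obtain \<mu> \<nu> where xs: "xs = [\<mu>, \<nu>]" "1 \<le> \<mu>" "\<mu> \<le> m" "1 \<le> \<nu>" "\<nu> \<le> n"
    by (auto simp: arrows_A_quiver verts_A_quiver length_Suc_conv less_Suc_eq numeral_2_eq_2
        all_conj_distrib)
  have "xs' = [Suc \<mu>, \<nu>] \<or> xs' = [\<mu>, Suc \<nu>] \<and> Suc \<nu> \<le> n"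
    using a unfolding xs(1) by (auto simp: arrows_A_quiver less_Suc_eq numeral_2_eq_2)
  then show "nabla_vertex i n xs \<le> nabla_vertex i n xs'"
    using xs assms by (auto simp: nabla_vertex_def)
qed (rule assms(1))

text \<open>Replacing two different vertices \<open>i < j\<close> by chains can be done in either order; doing \<open>i\<close> first shifts
  \<open>j\<close> to \<open>j + n - 1\<close>. This is the whole combinatorial content of the isomorphism of functors.\<close>

lemma nabla_vertex_exchange:
  assumes "1 \<le> n" "1 \<le> p" "i < j" "1 \<le> \<nu>" "\<nu> \<le> n" "1 \<le> \<pi>" "\<pi> \<le> p"
  shows "nabla_vertex i n [nabla_vertex j p [\<mu>, \<pi>], \<nu>] =
    nabla_vertex (j + n - 1) p [nabla_vertex i n [\<mu>, \<nu>], \<pi>]"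
  using assms by (auto simp: nabla_vertex_def Let_def)

theorem corollary4p2:
  fixes K :: "('k, 'z) ring_scheme" and m n p i j :: nat
  assumes "field K"
    and "m \<ge> 1" and "n \<ge> 1" and "p \<ge> 1"
    and "1 \<le> i" and "i < j" and "j \<le> m"
  shows "naturally_isomorphic
           (rep_cat K (A_quiver [m + n + p - 2]) ::
              ((nat list, 'k, 'v) rep, nat list \<Rightarrow> 'v \<Rightarrow> 'v) category)
           (rep_cat K (A_quiver [m, n, p]))
           (flip_functor m p n \<circ>\<^sub>F nabla K m j p [n] \<circ>\<^sub>F nabla K (m + p - 1) i n [])
           (nabla K m i n [p] \<circ>\<^sub>F nabla K (m + n - 1) (j + n - 1) p [])"
proof -
  have a: "m + p - 1 + n - 1 = m + n + p - 2" "m + n - 1 + p - 1 = m + n + p - 2"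
    using assms by simp_all
  have "pulls_back K (m + n + p - 2) (A_quiver [m + p - 1, n])
      (nabla K (m + p - 1) i n [] :: ((nat list, 'k, 'v) rep, _, _, _) cat_functor) (nabla_vertex i n)"
    unfolding nabla_def nabla_module_def a
    by (rule pulls_back_tensor_functor,
        rule initial_support_nabla[of K i "m + p - 1" n, unfolded a]) (use assms in simp_all)
  then have "pulls_back K (m + n + p - 2) (A_quiver ([m, p] @ [n]))
      (nabla K m j p [n] \<circ>\<^sub>F (nabla K (m + p - 1) i n [] :: ((nat list, 'k, 'v) rep, _, _, _) cat_functor))
      (\<lambda>z. nabla_vertex i n (split_vertex (nabla_vertex j p) (length [m, p]) z))"
    unfolding nabla_def[of K m j] nabla_module_def
    by (rule pulls_back_tensor_functor_comp) (rule initial_support_nabla, use assms in simp_all)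
  then have "pulls_back K (m + n + p - 2) (A_quiver [m, p, n])
      (nabla K m j p [n] \<circ>\<^sub>F (nabla K (m + p - 1) i n [] :: ((nat list, 'k, 'v) rep, _, _, _) cat_functor))
      (\<lambda>z. nabla_vertex i n (split_vertex (nabla_vertex j p) 2 z))"
    by (simp add: numeral_2_eq_2)
  note left = pulls_back_flip_functor_comp[OF this]
  have "pulls_back K (m + n + p - 2) (A_quiver [m + n - 1, p])
      (nabla K (m + n - 1) (j + n - 1) p [] :: ((nat list, 'k, 'v) rep, _, _, _) cat_functor)
      (nabla_vertex (j + n - 1) p)"
    unfolding nabla_def nabla_module_def a
    by (rule pulls_back_tensor_functor,
        rule initial_support_nabla[of K "j + n - 1" "m + n - 1" p, unfolded a]) (use assms in simp_all)
  then have "pulls_back K (m + n + p - 2) (A_quiver ([m, n] @ [p]))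
      (nabla K m i n [p] \<circ>\<^sub>F (nabla K (m + n - 1) (j + n - 1) p [] :: ((nat list, 'k, 'v) rep, _, _, _) cat_functor))
      (\<lambda>z. nabla_vertex (j + n - 1) p (split_vertex (nabla_vertex i n) (length [m, n]) z))"
    unfolding nabla_def[of K m i] nabla_module_def
    by (rule pulls_back_tensor_functor_comp) (rule initial_support_nabla, use assms in simp_all)
  then have right: "pulls_back K (m + n + p - 2) (A_quiver [m, n, p])
      (nabla K m i n [p] \<circ>\<^sub>F (nabla K (m + n - 1) (j + n - 1) p [] :: ((nat list, 'k, 'v) rep, _, _, _) cat_functor))
      (\<lambda>z. nabla_vertex (j + n - 1) p (split_vertex (nabla_vertex i n) 2 z))"
    by (simp add: numeral_2_eq_2)
  show ?thesis
  proof (rule naturally_isomorphic_if_pull_back_alike[OF left right])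
    fix z assume "z \<in> verts (A_quiver [m, n, p])"
    then obtain \<mu> \<nu> \<pi> where "z = [\<mu>, \<nu>, \<pi>]" "1 \<le> \<nu>" "\<nu> \<le> n" "1 \<le> \<pi>" "\<pi> \<le> p"
      by (auto simp: verts_A_quiver length_Suc_conv less_Suc_eq numeral_3_eq_3 numeral_2_eq_2
          all_conj_distrib)
    then show "nabla_vertex i n (split_vertex (nabla_vertex j p) 2 (swap_last_two z)) =
        nabla_vertex (j + n - 1) p (split_vertex (nabla_vertex i n) 2 z)"
      using nabla_vertex_exchange[of n p i j \<nu> \<pi> \<mu>] assms
      by (simp add: split_vertex_def swap_last_two_def)
  qed
qed

end
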